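(* There exists a structure $M$ such that $M$ is a transitive Fraïssé limit with no algebraicity that admits weak elimination of imaginaries, and such that $\mathrm{Aut}(M)$ is not de Finetti.
   Context: Fraïssé limit: $M$ is a Fraïssé limit if it is the Fraïssé limit of some Fraïssé class $\mathcal F$ of finite structures, i.e. $M$ is the countably infinite structure characterized by: the finite substructures of $M$ are, up to isomorphism, precisely the elements of $\mathcal F$, and every isomorphism $A\to B$ between finite substructures $A,B\subset M$ extends to an automorphism of $M$ (ultrahomogeneity). Let $G=\mathrm{Aut}(M)$, with the topology of pointwise convergence on $M$ (a Polish group), and for a tuple $\bar a\in M^k$ let $G_{\bar a}$ denote the (pointwise) stabilizer of $\bar a$ in $G$. - $M$ is transitive if for any $a,b\in M$ there is $g\in G$ such that $g\cdot a=b$. - $M$ has no algebraicity if for any tuple $\bar a\in M^k$ and any $x\in M$ with $x\notin\bar a$, the orbit $G_{\bar a}\cdot x$ is infinite. - $M$ admits weak elimination of imaginaries if for every proper, open subgroup $V<G$ there exist $k$ and a tuple $\bar a\in M^k$ such that $G_{\bar a}\le V$ and $[V:G_{\bar a}]<\infty$. For a set $Z$, the shift action of $G$ on $Z^M$ is $(g\cdot x)(a)=x(g^{-1}a)$ for $g\in G$, $x\in Z^M$, $a\in M$. For $Z$ standard Borel, a probability measure $\mu$ on $Z^M$ (with the product $\sigma$-algebra) is invariant if $\mu(g\cdot A)=\mu(A)$ for all $g\in G$ and all measurable $A\subset Z^M$. An invariant probability measure $\mu$ is ergodic if every measurable $A$ such that $\mu(A\triangle g\cdot A)=0$ for all $g\in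 G$ satisfies $\mu(A)\in\{0,1\}$. $\mathrm{Aut}(M)$ is de Finetti if for every standard Borel space $Z$, the only invariant, ergodic probability measures on $Z^M$ under the shift action are product measures of the form $\lambda^{\otimes M}$, where $\lambda$ is a probability measure on $Z$. *)

theory Defs
  imports
    "HOL-Probability.Probability"
    "HOL-Algebra.Coset"
    "HOL-Combinatorics.Permutations"
begin

section \<open>Relational structures\<close>

text \<open>
  A relational language is a type \<open>'r\<close> of relation symbols together with an arity function
  \<open>ar :: 'r \<Rightarrow> nat\<close>; the language is countable iff the type \<open>'r\<close> is.
\<close>

record ('r, 'a) rel_structure =
  univ :: "'a set"
  interp :: "'r \<Rightarrow> 'a list set"

definition is_structure :: "('r \<Rightarrow> nat) \<Rightarrow> ('r, 'a) rel_structure \<Rightarrow> bool" where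
  "is_structure ar A \<longleftrightarrow>
     (\<forall>r. \<forall>xs \<in> interp A r. length xs = ar r \<and> set xs \<subseteq> univ A)"

definition substructure_on :: "('r, 'a) rel_structure \<Rightarrow> 'a set \<Rightarrow> ('r, 'a) rel_structure" where
  "substructure_on A S = \<lparr>univ = S, interp = (\<lambda>r. {xs \<in> interp A r. set xs \<subseteq> S})\<rparr>"

text \<open>
  Between two structures of the same language the equivalence below is trivial for lists of the
  wrong length, so the arity function need not be mentioned.
\<close>

definition is_embedding ::
  "('a \<Rightarrow> 'b) \<Rightarrow> ('r, 'a) rel_structure \<Rightarrow> ('r, 'b) rel_structure \<Rightarrow> bool" where
  "is_embedding f A B \<longleftrightarrow>
     inj_on f (univ A) \<and> f ` univ A \<subseteq> univ B \<and>
     (\<forall>r xs. set xs \<subseteq> univ A \<longrightarrow> (xs \<in> interp A r \<longleftrightarrow> map f xs \<in> interp B r))"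

definition is_isomorphism ::
  "('a \<Rightarrow> 'b) \<Rightarrow> ('r, 'a) rel_structure \<Rightarrow> ('r, 'b) rel_structure \<Rightarrow> bool" where
  "is_isomorphism f A B \<longleftrightarrow> is_embedding f A B \<and> f ` univ A = univ B"

definition isomorphic :: "('r, 'a) rel_structure \<Rightarrow> ('r, 'b) rel_structure \<Rightarrow> bool" where
  "isomorphic A B \<longleftrightarrow> (\<exists>f. is_isomorphism f A B)"

text \<open>
  Automorphisms are normalised to be the identity outside the universe, so that distinct
  elements of \<open>Aut M\<close> differ on the universe and \<open>inv_into UNIV g\<close> is the inverse of \<open>g\<close> in \<open>Aut M\<close>.
\<close>

definition Aut :: "('r, 'a) rel_structure \<Rightarrow> ('a \<Rightarrow> 'a) set" where
  "Aut M = {g. g permutes univ M \<and> is_isomorphism g M M}"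


section \<open>Fraisse classes and limits\<close>

text \<open>
  A Fraisse class is closed under isomorphism, so it is represented by its members whose
  universe is a (finite) set of natural numbers.
\<close>

definition fraisse_class :: "('r \<Rightarrow> nat) \<Rightarrow> ('r, nat) rel_structure set \<Rightarrow> bool" where
  "fraisse_class ar F \<longleftrightarrow>
     (\<forall>A\<in>F. is_structure ar A \<and> finite (univ A)) \<and>
     \<comment> \<open>closed under isomorphism\<close>
     (\<forall>A\<in>F. \<forall>B. is_structure ar B \<and> isomorphic A B \<longrightarrow> B \<in> F) \<and>
     \<comment> \<open>countably many members up to isomorphism\<close>
     (\<exists>C\<subseteq>F. countable C \<and> (\<forall>A\<in>F. \<exists>B\<in>C. isomorphic A B)) \<and>
     \<comment> \<open>members of arbitrarily large finite size\<close>
     (\<forall>n. \<exists>A\<in>F. n \<le> card (univ A)) \<and>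
     \<comment> \<open>hereditary property\<close>
     (\<forall>A\<in>F. \<forall>S\<subseteq>univ A. substructure_on A S \<in> F) \<and>
     \<comment> \<open>joint embedding property\<close>
     (\<forall>A\<in>F. \<forall>B\<in>F. \<exists>C\<in>F. \<exists>f g. is_embedding f A C \<and> is_embedding g B C) \<and>
     \<comment> \<open>amalgamation property\<close>
     (\<forall>A\<in>F. \<forall>B\<in>F. \<forall>C\<in>F. \<forall>f g. is_embedding f A B \<and> is_embedding g A C \<longrightarrow>
        (\<exists>D\<in>F. \<exists>h k. is_embedding h B D \<and> is_embedding k C D \<and>
           (\<forall>a\<in>univ A. h (f a) = k (g a))))"

definition ultrahomogeneous :: "('r, 'a) rel_structure \<Rightarrow> bool" where
  "ultrahomogeneous M \<longleftrightarrow>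
     (\<forall>S T f. finite S \<and> S \<subseteq> univ M \<and> finite T \<and> T \<subseteq> univ M \<and>
        is_isomorphism f (substructure_on M S) (substructure_on M T) \<longrightarrow>
        (\<exists>g\<in>Aut M. \<forall>a\<in>S. g a = f a))"

definition fraisse_limit_of ::
  "('r \<Rightarrow> nat) \<Rightarrow> ('r, nat) rel_structure set \<Rightarrow> ('r, 'a) rel_structure \<Rightarrow> bool" where
  "fraisse_limit_of ar F M \<longleftrightarrow>
     is_structure ar M \<and> countable (univ M) \<and> infinite (univ M) \<and>
     (\<forall>S. finite S \<and> S \<subseteq> univ M \<longrightarrow> (\<exists>A\<in>F. isomorphic (substructure_on M S) A)) \<and>
     (\<forall>A\<in>F. \<exists>S. finite S \<and> S \<subseteq> univ M \<and> isomorphic A (substructure_on M S)) \<and>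
     ultrahomogeneous M"

definition fraisse_limit :: "('r \<Rightarrow> nat) \<Rightarrow> ('r, 'a) rel_structure \<Rightarrow> bool" where
  "fraisse_limit ar M \<longleftrightarrow> (\<exists>F. fraisse_class ar F \<and> fraisse_limit_of ar F M)"


section \<open>The automorphism group\<close>

definition aut_group :: "('r, 'a) rel_structure \<Rightarrow> ('a \<Rightarrow> 'a) monoid" where
  "aut_group M = \<lparr>carrier = Aut M, mult = (\<circ>), one = id\<rparr>"

text \<open>The topology of pointwise convergence, the universe being discrete.\<close>

definition aut_topology :: "('r, 'a) rel_structure \<Rightarrow> ('a \<Rightarrow> 'a) topology" where
  "aut_topology M =
     subtopology (product_topology (\<lambda>_. discrete_topology UNIV) UNIV) (Aut M)"

text \<open>Tuples are lists; this is the pointwise stabiliser.\<close>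

definition tuple_stabilizer :: "('r, 'a) rel_structure \<Rightarrow> 'a list \<Rightarrow> ('a \<Rightarrow> 'a) set" where
  "tuple_stabilizer M as = {g \<in> Aut M. \<forall>a\<in>set as. g a = a}"

definition transitive_structure :: "('r, 'a) rel_structure \<Rightarrow> bool" where
  "transitive_structure M \<longleftrightarrow> (\<forall>a\<in>univ M. \<forall>b\<in>univ M. \<exists>g\<in>Aut M. g a = b)"

definition no_algebraicity :: "('r, 'a) rel_structure \<Rightarrow> bool" where
  "no_algebraicity M \<longleftrightarrow>
     (\<forall>as x. set as \<subseteq> univ M \<and> x \<in> univ M \<and> x \<notin> set as \<longrightarrow>
        infinite ((\<lambda>g. g x) ` tuple_stabilizer M as))"

definition weak_elimination_of_imaginaries :: "('r, 'a) rel_structure \<Rightarrow> bool" where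
  "weak_elimination_of_imaginaries M \<longleftrightarrow>
     (\<forall>V. subgroup V (aut_group M) \<and> V \<noteq> carrier (aut_group M) \<and> openin (aut_topology M) V \<longrightarrow>
        (\<exists>as. set as \<subseteq> univ M \<and> tuple_stabilizer M as \<subseteq> V \<and>
           finite (rcosets\<^bsub>(aut_group M)\<lparr>carrier := V\<rparr>\<^esub> (tuple_stabilizer M as))))"


section \<open>Invariant measures and the de Finetti property\<close>

text \<open>Measurable spaces whose sigma-algebra is generated by a Polish topology.\<close>

definition standard_borel :: "'z measure \<Rightarrow> bool" where
  "standard_borel Z \<longleftrightarrow>
     (\<exists>T. topspace T = space Z \<and> completely_metrizable_space T \<and>
        separable_space T \<and>
        sets Z = sigma_sets (space Z) {U. openin T U})"

text \<open>
  The space of functions from the universe to \<open>Z\<close>, with its product sigma-algebra. Its points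
  are extensional functions, a property which the shift preserves because automorphisms are the
  identity outside the universe.
\<close>

abbreviation config_space :: "('r, 'a) rel_structure \<Rightarrow> 'z measure \<Rightarrow> ('a \<Rightarrow> 'z) measure" where
  "config_space M Z \<equiv> PiM (univ M) (\<lambda>_. Z)"

definition shift_act :: "('a \<Rightarrow> 'a) \<Rightarrow> ('a \<Rightarrow> 'z) \<Rightarrow> ('a \<Rightarrow> 'z)" where
  "shift_act g x = (\<lambda>a. x (inv_into UNIV g a))"

definition invariant_prob ::
  "('r, 'a) rel_structure \<Rightarrow> 'z measure \<Rightarrow> ('a \<Rightarrow> 'z) measure \<Rightarrow> bool" where
  "invariant_prob M Z \<mu> \<longleftrightarrow>
     prob_space \<mu> \<and> sets \<mu> = sets (config_space M Z) \<and>
     (\<forall>g\<in>Aut M. \<forall>A\<in>sets \<mu>. measure \<mu> (shift_act g ` A) = measure \<mu> A)"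

definition ergodic_prob ::
  "('r, 'a) rel_structure \<Rightarrow> 'z measure \<Rightarrow> ('a \<Rightarrow> 'z) measure \<Rightarrow> bool" where
  "ergodic_prob M Z \<mu> \<longleftrightarrow>
     invariant_prob M Z \<mu> \<and>
     (\<forall>A\<in>sets \<mu>. (\<forall>g\<in>Aut M. measure \<mu> (sym_diff A (shift_act g ` A)) = 0) \<longrightarrow>
        measure \<mu> A = 0 \<or> measure \<mu> A = 1)"

text \<open>
  A standard Borel space has at most continuum many points, so up to isomorphism every standard
  Borel space has its points among the reals; \<open>Z\<close> carries an arbitrary standard Borel structure
  on an arbitrary such set, not necessarily the usual one.
\<close>

definition de_finetti :: "('r, 'a) rel_structure \<Rightarrow> bool" where
  "de_finetti M \<longleftrightarrow>
     (\<forall>(Z :: real measure) \<mu>. standard_borel Z \<and> ergodic_prob M Z \<mu> \<longrightarrow>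
        (\<exists>L. prob_space L \<and> sets L = sets Z \<and> \<mu> = PiM (univ M) (\<lambda>_. L)))"

end

theory Submission
  imports Defs
begin

text \<open>
  The structure is a generic random field. Fix a random set \<open>X\<close> of naturals, all of whose finite
  patterns have positive rational probability and each of whose points belongs to \<open>X\<close> with
  probability \<open>1/2\<close>, such that every one-point extension of a finite marginal by a new fair bit is
  already realised by some natural number. Name by relations the joint laws of all finite tuples.
  The one-point extension property gives ultrahomogeneity by back and forth; conditionally
  independent extensions give absence of algebraicity. The law of \<open>X\<close> is an invariant measure by
  construction. It is ergodic because every finite set has an independent copy, and it is not a
  product because some pairs are correlated.

  For weak elimination of imaginaries one shows that an open subgroup has a least support, i.e. that
  containing the stabilisers of \<open>C \<union> {a}\<close> and of some finite \<open>D \<supseteq> C\<close> with \<open>a \<notin> D\<close> forces it to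
  contain the stabiliser of \<open>C\<close>. The stabiliser of \<open>D\<close> moves \<open>a\<close> to every point that disagrees with
  it with small probability over \<open>C\<close>, and every point of the type of \<open>a\<close> over \<open>C\<close> is reached
  by a chain of such moves.
\<close>

text \<open>Probabilities are rational so that there are only countably many relation symbols and
  countably many one-point extension problems, each of which can be given its own natural number.
  All points must have the same one-point law for the structure to be transitive; \<open>1/2\<close>
  is a convenient common value. The obstacle to least supports is that one move is not enough. If
  \<open>a\<close> is almost determined by \<open>D\<close>, then a point having the type of
  \<open>a\<close> over \<open>D\<close> can disagree with \<open>a\<close> only with small
  probability, while a point having the type of \<open>a\<close> over \<open>C\<close> alone may
  disagree with it much more. Only close points are therefore reached directly. The extension
  property provides points that interpolate between \<open>a\<close> and a given point of its type,
  roughly halving the disagreement, and probabilities are at most 1, so finitely many interpolations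
  suffice.\<close>

lemma sum_Pow_insert:
  fixes h :: "'a set \<Rightarrow> 'b::comm_monoid_add"
  assumes "finite S" "a \<notin> S"
  shows "(\<Sum>T\<in>Pow (insert a S). h T) = (\<Sum>T\<in>Pow S. h T + h (insert a T))"
proof -
  have "inj_on (insert a) (Pow S)"
    using assms(2) by (intro inj_onI) (metis Diff_insert_absorb PowD subsetD)
  moreover have "Pow S \<inter> insert a ` Pow S = {}"
    using assms(2) by auto
  ultimately show ?thesis
    using assms(1) by (simp add: Pow_insert sum.union_disjoint sum.reindex sum.distrib)
qed

lemma sum_Collect_if:
  fixes f :: "'a \<Rightarrow> 'b::comm_monoid_add"
  assumes "finite A"
  shows "(\<Sum>x\<in>A. if P x then f x else 0) = (\<Sum>x\<in>{x\<in>A. P x}. f x)"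
  using sum.inter_filter[OF assms, of f P] by simp

section \<open>Laws of random subsets\<close>

text \<open>The rational \<open>w S T\<close> stands for the probability that a random set of naturals meets the
  finite set \<open>S\<close> in exactly \<open>T\<close>.\<close>

locale coherent =
  fixes w :: "nat set \<Rightarrow> nat set \<Rightarrow> rat"
  assumes total: "w {} {} = 1"
    and pos: "finite S \<Longrightarrow> T \<subseteq> S \<Longrightarrow> 0 < w S T"
    and split: "finite S \<Longrightarrow> a \<notin> S \<Longrightarrow> T \<subseteq> S \<Longrightarrow>
      w S T = w (insert a S) T + w (insert a S) (insert a T)"
begin

text \<open>Expectations of functions of the trace on \<open>S\<close> can be computed on any larger
  window: the points of \<open>D - S\<close> are added one at a time, and \<open>split\<close>
  recombines the two cases.\<close>

lemma sum_marginal: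
  assumes "finite D" "S \<subseteq> D"
  shows "(\<Sum>Z\<in>Pow D. h (Z \<inter> S) * w D Z) = (\<Sum>T\<in>Pow S. h T * w S T)"
proof -
  have "finite E \<Longrightarrow> E \<inter> S = {} \<Longrightarrow>
    (\<Sum>Z\<in>Pow (S \<union> E). h (Z \<inter> S) * w (S \<union> E) Z) = (\<Sum>T\<in>Pow S. h T * w S T)" for E
  proof (induction E rule: finite_induct)
    case empty
    then show ?case by (auto intro!: sum.cong simp: Int_absorb2)
  next
    case (insert a E)
    have fin: "finite (S \<union> E)" and a: "a \<notin> S \<union> E"
      using insert assms finite_subset by auto
    have "(\<Sum>Z\<in>Pow (S \<union> insert a E). h (Z \<inter> S) * w (S \<union> insert a E) Z)
      = (\<Sum>Z\<in>Pow (S \<union> E). h (Z \<inter> S) * w (insert a (S \<union> E)) Z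
          + h (insert a Z \<inter> S) * w (insert a (S \<union> E)) (insert a Z))"
      using sum_Pow_insert[OF fin a] by simp
    also have "\<dots> = (\<Sum>Z\<in>Pow (S \<union> E). h (Z \<inter> S) * w (S \<union> E) Z)"
    proof (rule sum.cong[OF refl])
      fix Z assume "Z \<in> Pow (S \<union> E)"
      then have "w (S \<union> E) Z = w (insert a (S \<union> E)) Z + w (insert a (S \<union> E)) (insert a Z)"
        using split[OF fin a] by auto
      moreover have "insert a Z \<inter> S = Z \<inter> S" using a by auto
      ultimately show "h (Z \<inter> S) * w (insert a (S \<union> E)) Z
          + h (insert a Z \<inter> S) * w (insert a (S \<union> E)) (insert a Z) = h (Z \<inter> S) * w (S \<union> E) Z"
        by (simp add: distrib_left)
    qed
    finally show ?case using insert by auto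
  qed
  moreover have "S \<union> (D - S) = D" "(D - S) \<inter> S = {}" "finite (D - S)" using assms by auto
  ultimately show ?thesis by metis
qed

lemma marginal:
  assumes "finite D" "S \<subseteq> D" "T \<subseteq> S"
  shows "w S T = (\<Sum>Z\<in>{Z\<in>Pow D. Z \<inter> S = T}. w D Z)"
proof -
  have fS: "finite S" using assms finite_subset by auto
  have "(\<Sum>Z\<in>Pow D. of_bool (Z \<inter> S = T) * w D Z) = (\<Sum>Z\<in>Pow S. of_bool (Z = T) * w S Z)"
    using sum_marginal[OF assms(1,2), of "\<lambda>Z. of_bool (Z = T)"] .
  also have "\<dots> = w S T"
    using assms fS by (simp add: of_bool_def if_distrib[of "\<lambda>x. x * _"] cong: if_cong)
  finally show ?thesis
    unfolding sum_Collect_if[OF finite_Pow_iff[THEN iffD2, OF assms(1)], symmetric]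
    by (simp add: of_bool_def if_distrib[of "\<lambda>x. x * _"] cong: if_cong)
qed

text \<open>The form of \<open>marginal\<close> that matches the extension property, where a new
  point is described by the patterns that contain it.\<close>

lemma marginal_insert:
  assumes "finite D" "S \<subseteq> D" "T \<subseteq> S" "b \<notin> D"
  shows "w (insert b S) (insert b T) = (\<Sum>Z\<in>{Z\<in>Pow D. Z \<inter> S = T}. w (insert b D) (insert b Z))"
proof -
  have eq: "{Z\<in>Pow (insert b D). Z \<inter> insert b S = insert b T} = insert b ` {Z\<in>Pow D. Z \<inter> S = T}"
    (is "?L = ?R")
  proof
    show "?L \<subseteq> ?R"
    proof
      fix Z assume Z: "Z \<in> ?L"
      then have "b \<in> Z" by auto
      then have "Z = insert b (Z - {b})" by auto
      moreover have "Z - {b} \<in> {Z\<in>Pow D. Z \<inter> S = T}" using Z assms by auto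
      ultimately show "Z \<in> ?R" by blast
    qed
    show "?R \<subseteq> ?L" using assms by auto
  qed
  have inj: "inj_on (insert b) {Z\<in>Pow D. Z \<inter> S = T}"
    using assms(4) by (intro inj_onI) (metis (no_types, lifting) Diff_insert_absorb PowD mem_Collect_eq subsetD)
  have "w (insert b S) (insert b T)
    = (\<Sum>Z\<in>{Z\<in>Pow (insert b D). Z \<inter> insert b S = insert b T}. w (insert b D) Z)"
    by (rule marginal) (use assms in auto)
  then show ?thesis
    unfolding eq sum.reindex[OF inj] by simp
qed

lemma marginal_le:
  assumes "finite D" "S \<subseteq> D" "Z \<subseteq> D"
  shows "w D Z \<le> w S (Z \<inter> S)"
proof -
  have "w D Z \<le> (\<Sum>Z'\<in>{Z'\<in>Pow D. Z' \<inter> S = Z \<inter> S}. w D Z')"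
    by (rule member_le_sum) (use assms in \<open>auto intro: less_imp_le[OF pos]\<close>)
  then show ?thesis using marginal[OF assms(1,2), of "Z \<inter> S"] by simp
qed

section \<open>Injections that preserve the law\<close>

definition preserves :: "(nat \<Rightarrow> nat) \<Rightarrow> nat set \<Rightarrow> bool" where
  "preserves f S \<longleftrightarrow> inj_on f S \<and> (\<forall>T\<subseteq>S. w (f ` S) (f ` T) = w S T)"

text \<open>Laws on a subset are sums of laws on \<open>D\<close>, and \<open>f\<close> carries the
  index set of one such sum bijectively onto that of the other.\<close>

lemma preserves_subset:
  assumes "preserves f D" "finite D" "S \<subseteq> D"
  shows "preserves f S"
  unfolding preserves_def
proof (intro conjI allI impI)
  have inj: "inj_on f D" using assms by (simp add: preserves_def)
  then show "inj_on f S" using assms(3) inj_on_subset by blast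
  fix T assume T: "T \<subseteq> S"
  have eq: "{Z\<in>Pow (f ` D). Z \<inter> f ` S = f ` T} = (`) f ` {Z\<in>Pow D. Z \<inter> S = T}" (is "?L = ?R")
  proof
    show "?L \<subseteq> ?R"
    proof
      fix Z assume Z: "Z \<in> ?L"
      then obtain Y where Y: "Y \<subseteq> D" "Z = f ` Y" by (auto simp: subset_image_iff)
      then have "f ` (Y \<inter> S) = f ` T"
        using Z assms(3) by (simp add: inj_on_image_Int[OF inj])
      then have "Y \<inter> S = T"
        using inj_on_image_eq_iff[OF inj] T assms(3) Y by (meson Int_lower2 subset_trans)
      then show "Z \<in> ?R" using Y by auto
    qed
    show "?R \<subseteq> ?L"
    proof
      fix Z assume "Z \<in> ?R"
      then obtain Y where Y: "Y \<subseteq> D" "Y \<inter> S = T" "Z = f ` Y" by auto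
      then have "f ` Y \<inter> f ` S = f ` T"
        using inj_on_image_Int[OF inj Y(1) assms(3)] by simp
      then show "Z \<in> ?L" using Y by auto
    qed
  qed
  have inj2: "inj_on ((`) f) {Z\<in>Pow D. Z \<inter> S = T}"
    using inj by (intro inj_onI) (auto simp: inj_on_image_eq_iff[OF inj])
  have "w (f ` S) (f ` T) = (\<Sum>Z\<in>{Z\<in>Pow (f ` D). Z \<inter> f ` S = f ` T}. w (f ` D) Z)"
    by (rule marginal) (use assms T in auto)
  also have "\<dots> = (\<Sum>Z\<in>{Z\<in>Pow D. Z \<inter> S = T}. w (f ` D) (f ` Z))"
    unfolding eq sum.reindex[OF inj2] by simp
  also have "\<dots> = (\<Sum>Z\<in>{Z\<in>Pow D. Z \<inter> S = T}. w D Z)"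
    using assms(1) by (intro sum.cong) (auto simp: preserves_def)
  also have "\<dots> = w S T"
    by (rule marginal[symmetric]) (use assms T in auto)
  finally show "w (f ` S) (f ` T) = w S T" .
qed

lemma preserves_cong:
  assumes "\<And>x. x \<in> S \<Longrightarrow> f x = g x"
  shows "preserves f S \<longleftrightarrow> preserves g S"
proof -
  have im: "f ` T = g ` T" if "T \<subseteq> S" for T using assms that by (intro image_cong) auto
  show ?thesis
    unfolding preserves_def using inj_on_cong[of S f g] assms im by auto
qed

lemma preserves_id [simp]: "preserves (\<lambda>x. x) S"
  by (simp add: preserves_def)

lemma preserves_comp:
  assumes "preserves f S" "preserves g (f ` S)"
  shows "preserves (g \<circ> f) S"
  unfolding preserves_def
proof (intro conjI allI impI)
  show "inj_on (g \<circ> f) S" using assms by (auto simp: preserves_def intro: comp_inj_on)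
  fix T assume T: "T \<subseteq> S"
  then have "w (g ` f ` S) (g ` f ` T) = w (f ` S) (f ` T)"
    using assms(2) by (auto simp: preserves_def image_mono)
  then show "w ((g \<circ> f) ` S) ((g \<circ> f) ` T) = w S T"
    using assms(1) T by (simp only: image_comp[symmetric] preserves_def)
qed

lemma preserves_inverse:
  assumes "preserves f S" "\<And>x. x \<in> S \<Longrightarrow> g (f x) = x"
  shows "preserves g (f ` S)"
  unfolding preserves_def
proof (intro conjI allI impI)
  show "inj_on g (f ` S)" using assms(2) by (intro inj_onI) auto
  have im: "g ` f ` T = T" if "T \<subseteq> S" for T
    using assms(2) that by (force simp: image_image)
  fix T assume "T \<subseteq> f ` S"
  then obtain U where U: "U \<subseteq> S" "T = f ` U" by (auto simp: subset_image_iff)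
  then show "w (g ` f ` S) (g ` T) = w (f ` S) T"
    using assms(1) im by (auto simp: preserves_def)
qed

text \<open>Patterns that omit the new point are controlled by subtraction: \<open>split\<close>
  expresses their probability as that of the pattern on \<open>S\<close> minus that of the pattern
  enlarged by the new point.\<close>

lemma preserves_insertI:
  assumes f: "preserves f S" and S: "finite S" "a \<notin> S" and b: "b \<notin> f ` S" "f a = b"
    and eq: "\<And>T. T \<subseteq> S \<Longrightarrow> w (insert b (f ` S)) (insert b (f ` T)) = w (insert a S) (insert a T)"
  shows "preserves f (insert a S)"
  unfolding preserves_def
proof (intro conjI allI impI)
  show "inj_on f (insert a S)" using f S b by (auto simp: preserves_def)
  fix T assume T: "T \<subseteq> insert a S"
  show "w (f ` insert a S) (f ` T) = w (insert a S) T"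
  proof (cases "a \<in> T")
    case True
    then have "w (insert b (f ` S)) (insert b (f ` (T - {a}))) = w (insert a S) (insert a (T - {a}))"
      using T by (intro eq) auto
    moreover have "insert b (f ` (T - {a})) = f ` T" using True b by auto
    ultimately show ?thesis using b True by (simp add: insert_absorb)
  next
    case False
    then have TS: "T \<subseteq> S" using T by auto
    have "w (f ` S) (f ` T) = w (insert b (f ` S)) (f ` T) + w (insert b (f ` S)) (insert b (f ` T))"
      using S b TS by (intro split) auto
    moreover have "w S T = w (insert a S) T + w (insert a S) (insert a T)"
      using S TS by (intro split) auto
    ultimately show ?thesis using f eq[OF TS] TS b by (simp add: preserves_def)
  qed
qed

end

section \<open>Generic laws and their homogeneity\<close>

text \<open>In \<open>ext\<close>, \<open>v T\<close> prescribes the probability that the trace on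
  \<open>S\<close> is \<open>T\<close> and the new point lies in the random set. The strict
  inequalities are those that \<open>pos\<close> imposes on every new point and the sum is the one
  that \<open>half\<close> imposes, so all conceivable rational one-point types are
  realised.\<close>

locale generic = coherent +
  assumes half: "w {a} {a} = 1/2"
    and ext: "finite S \<Longrightarrow> (\<And>T. T \<subseteq> S \<Longrightarrow> 0 < v T \<and> v T < w S T) \<Longrightarrow> (\<Sum>T\<in>Pow S. v T) = 1/2 \<Longrightarrow>
      \<exists>b. b \<notin> S \<and> (\<forall>T\<subseteq>S. w (insert b S) (insert b T) = v T)"
begin

text \<open>To keep the new point out of \<open>K\<close>, make it conditionally independent of \<open>K\<close> given \<open>S\<close>.\<close>

lemma ext_avoid:
  assumes "finite S" "finite K" and v: "\<And>T. T \<subseteq> S \<Longrightarrow> 0 < v T \<and> v T < w S T"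
    and sum: "(\<Sum>T\<in>Pow S. v T) = 1/2"
  obtains b where "b \<notin> S" "b \<notin> K" "\<And>T. T \<subseteq> S \<Longrightarrow> w (insert b S) (insert b T) = v T"
proof -
  define D where "D = S \<union> K"
  have D: "finite D" "S \<subseteq> D" using assms by (auto simp: D_def)
  \<comment> \<open>The conditional probability of the new point given the trace \<open>T\<close> on
    \<open>S\<close>. Used unchanged over \<open>D\<close>, it ignores the rest of
    \<open>K\<close>.\<close>
  define k where "k T = v T / w S T" for T
  have k: "0 < k T" "k T < 1" "k T * w S T = v T" if "T \<subseteq> S" for T
    using v[OF that] pos[OF assms(1) that] by (auto simp: k_def)
  have "\<exists>b. b \<notin> D \<and> (\<forall>Z\<subseteq>D. w (insert b D) (insert b Z) = k (Z \<inter> S) * w D Z)"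
  proof (rule ext[OF D(1)])
    fix Z assume "Z \<subseteq> D"
    then show "0 < k (Z \<inter> S) * w D Z \<and> k (Z \<inter> S) * w D Z < w D Z"
      using k(1,2)[of "Z \<inter> S"] pos[OF D(1), of Z] by simp
  next
    show "(\<Sum>Z\<in>Pow D. k (Z \<inter> S) * w D Z) = 1/2"
      using sum_marginal[OF D, of k] sum k(3) by simp
  qed
  then obtain b where b: "b \<notin> D" "\<And>Z. Z \<subseteq> D \<Longrightarrow> w (insert b D) (insert b Z) = k (Z \<inter> S) * w D Z"
    by blast
  have "w (insert b S) (insert b T) = v T" if T: "T \<subseteq> S" for T
  proof -
    have "w (insert b S) (insert b T) = (\<Sum>Z\<in>{Z\<in>Pow D. Z \<inter> S = T}. k T * w D Z)"
      using marginal_insert[OF D T b(1)] b(2) by simp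
    also have "\<dots> = k T * w S T"
      using marginal[OF D T] by (simp add: sum_distrib_left)
    finally show ?thesis using k(3)[OF T] by simp
  qed
  then show ?thesis using that b(1) unfolding D_def by auto
qed

text \<open>Together with \<open>new_point_bounds\<close> this verifies the hypotheses of
  \<open>ext\<close> for the type of an existing point, so that types can be copied.\<close>

lemma sum_new_point:
  assumes "finite S" "a \<notin> S"
  shows "(\<Sum>T\<in>Pow S. w (insert a S) (insert a T)) = 1/2"
proof -
  have "w (insert a {}) (insert a {}) = (\<Sum>Z\<in>{Z\<in>Pow S. Z \<inter> {} = {}}. w (insert a S) (insert a Z))"
    by (rule marginal_insert) (use assms in auto)
  moreover have "{Z\<in>Pow S. Z \<inter> {} = {}} = Pow S" by auto
  ultimately show ?thesis using half by metis
qed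

lemma new_point_bounds:
  assumes "finite S" "a \<notin> S" "T \<subseteq> S"
  shows "0 < w (insert a S) (insert a T)" "w (insert a S) (insert a T) < w S T"
  using split[OF assms] pos[of "insert a S" "insert a T"] pos[of "insert a S" T] assms by auto

text \<open>The forth step: the type of \<open>a\<close> over \<open>S\<close> is transported along
  \<open>f\<close> and realised over the image of \<open>S\<close>.\<close>

lemma preserves_extend:
  assumes f: "preserves f S" and S: "finite S"
  obtains g where "preserves g (insert a S)" "\<And>x. x \<in> S \<Longrightarrow> g x = f x"
proof (cases "a \<in> S")
  case True
  then show ?thesis using that[of f] f by (simp add: insert_absorb)
next
  case a: False
  have inj: "inj_on f S" using f by (simp add: preserves_def)
  define v where "v Y = w (insert a S) (insert a (S \<inter> f -` Y))" for Y
  have pre: "S \<inter> f -` f ` T = T" if "T \<subseteq> S" for T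
    using inj that by (auto simp: inj_on_def)
  have "\<exists>b. b \<notin> f ` S \<and> (\<forall>Y\<subseteq>f ` S. w (insert b (f ` S)) (insert b Y) = v Y)"
  proof (rule ext)
    show "finite (f ` S)" using S by simp
    fix Y assume "Y \<subseteq> f ` S"
    then obtain T where T: "T \<subseteq> S" "Y = f ` T" by (auto simp: subset_image_iff)
    then show "0 < v Y \<and> v Y < w (f ` S) Y"
      using new_point_bounds[OF S a T(1)] f pre[OF T(1)] by (simp add: v_def preserves_def)
  next
    have "(\<Sum>Y\<in>Pow (f ` S). v Y) = (\<Sum>T\<in>Pow S. v (f ` T))"
      using sum.reindex[OF inj_on_image_Pow[OF inj], of v] by (simp add: image_Pow_surj)
    also have "\<dots> = (\<Sum>T\<in>Pow S. w (insert a S) (insert a T))"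
      by (intro sum.cong) (auto simp: v_def pre)
    also have "\<dots> = 1/2" by (rule sum_new_point[OF S a])
    finally show "(\<Sum>Y\<in>Pow (f ` S). v Y) = 1/2" .
  qed
  then obtain b where b: "b \<notin> f ` S" "\<And>Y. Y \<subseteq> f ` S \<Longrightarrow> w (insert b (f ` S)) (insert b Y) = v Y"
    by blast
  define g where "g = f(a := b)"
  have gf: "g x = f x" if "x \<in> S" for x using that a by (auto simp: g_def)
  have im: "g ` T = f ` T" if "T \<subseteq> S" for T using that gf by (intro image_cong) auto
  have "preserves g (insert a S)"
  proof (rule preserves_insertI[OF _ S a])
    show "preserves g S" using preserves_cong[of S g f] gf f by auto
    show "b \<notin> g ` S" using b im by auto
    show "g a = b" by (simp add: g_def)
    fix T assume T: "T \<subseteq> S"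
    then have "w (insert b (f ` S)) (insert b (f ` T)) = v (f ` T)" by (intro b(2)) auto
    then show "w (insert b (g ` S)) (insert b (g ` T)) = w (insert a S) (insert a T)"
      using T im by (simp add: v_def pre)
  qed
  then show ?thesis using that gf by blast
qed

text \<open>The back step: the inverse of \<open>f\<close> is extended to \<open>b\<close> by the
  forth step, and the extension is inverted again.\<close>

lemma preserves_extend_range:
  assumes f: "preserves f S" and S: "finite S"
  obtains g S' where "finite S'" "S \<subseteq> S'" "preserves g S'" "b \<in> g ` S'" "\<And>x. x \<in> S \<Longrightarrow> g x = f x"
proof (cases "b \<in> f ` S")
  case True
  then show ?thesis using that[of S f] f S by auto
next
  case b: False
  have inj: "inj_on f S" using f by (simp add: preserves_def)
  let ?h = "inv_into S f"
  have inv: "?h (f x) = x" if "x \<in> S" for x using inj that by simp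
  obtain h where h: "preserves h (insert b (f ` S))" "\<And>y. y \<in> f ` S \<Longrightarrow> h y = ?h y"
    using preserves_extend[OF preserves_inverse[OF f inv]] S by (metis finite_imageI)
  have injh: "inj_on h (insert b (f ` S))" using h(1) by (simp add: preserves_def)
  define g where "g = inv_into (insert b (f ` S)) h"
  have gh: "g (h y) = y" if "y \<in> insert b (f ` S)" for y
    unfolding g_def by (rule inv_into_f_f[OF injh that])
  have hf: "h (f x) = x" if "x \<in> S" for x using h(2) inv that by auto
  show ?thesis
  proof (rule that[of "h ` insert b (f ` S)" g])
    show "preserves g (h ` insert b (f ` S))"
      by (rule preserves_inverse[OF h(1) gh])
    show "S \<subseteq> h ` insert b (f ` S)"
    proof
      fix x assume "x \<in> S"
      then have "x = h (f x)" "f x \<in> f ` S" using hf by auto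
      then show "x \<in> h ` insert b (f ` S)" by blast
    qed
    have "g (h b) = b" using gh by blast
    then show "b \<in> g ` h ` insert b (f ` S)" by (metis image_eqI insertI1)
    show "g x = f x" if "x \<in> S" for x
      using gh[of "f x"] hf[OF that] that by auto
  qed (use S in auto)
qed

text \<open>Back and forth: step \<open>n\<close> puts \<open>n\<close> into the domain and into the range.\<close>

lemma preserves_extends_to_bij:
  assumes f: "preserves f S" and S: "finite S"
  obtains g where "bij g" "\<And>D. finite D \<Longrightarrow> preserves g D" "\<And>x. x \<in> S \<Longrightarrow> g x = f x"
proof -
  define P where "P n q \<longleftrightarrow> finite (snd q) \<and> preserves (fst q) (snd q)
      \<and> (n > 0 \<longrightarrow> n - 1 \<in> snd q \<and> n - 1 \<in> fst q ` snd q)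
      \<and> S \<subseteq> snd q \<and> (\<forall>x\<in>S. fst q x = f x)" for n :: nat and q
  define R where "R q q' \<longleftrightarrow> snd q \<subseteq> snd q' \<and> (\<forall>x\<in>snd q. fst q' x = fst q x)"
    for q q' :: "(nat \<Rightarrow> nat) \<times> nat set"
  have "\<exists>F. \<forall>n. P n (F n) \<and> R (F n) (F (Suc n))"
  proof (rule dependent_nat_choice)
    show "\<exists>q. P 0 q" using f S by (intro exI[of _ "(f, S)"]) (auto simp: P_def)
    fix q n assume q: "P n q"
    obtain h where h: "preserves h (insert n (snd q))" "\<And>x. x \<in> snd q \<Longrightarrow> h x = fst q x"
      using preserves_extend[of "fst q" "snd q" n] q by (metis P_def)
    obtain g S' where g: "finite S'" "insert n (snd q) \<subseteq> S'" "preserves g S'" "n \<in> g ` S'"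
        "\<And>x. x \<in> insert n (snd q) \<Longrightarrow> g x = h x"
      using preserves_extend_range[OF h(1), of n] q by (metis P_def finite_insert)
    show "\<exists>q'. P (Suc n) q' \<and> R q q'"
      using g h q by (intro exI[of _ "(g, S')"]) (auto simp: P_def R_def subset_iff)
  qed
  then obtain F where F: "\<And>n. P n (F n)" "\<And>n. R (F n) (F (Suc n))" by blast
  have mono: "snd (F m) \<subseteq> snd (F n) \<and> (\<forall>x\<in>snd (F m). fst (F n) x = fst (F m) x)" if "m \<le> n" for m n
    using that
  proof (induction n rule: dec_induct)
    case (step n)
    then show ?case using F(2)[of n] by (auto simp: R_def)
  qed simp
  \<comment> \<open>Index \<open>n > 0\<close> of \<open>P\<close> guarantees the point
    \<open>n - 1\<close>, so the domain at index \<open>Suc x\<close> is certain to contain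
    \<open>x\<close>.\<close>
  define g where "g x = fst (F (Suc x)) x" for x
  have dom: "x \<in> snd (F (Suc x))" for x using F(1)[of "Suc x"] by (auto simp: P_def)
  have g: "g x = fst (F n) x" if "x \<in> snd (F n)" for x n
    using mono[of "Suc x" n] mono[of n "Suc x"] dom[of x] that unfolding g_def
    by (cases "Suc x \<le> n") auto
  have pres: "preserves g D" if D: "finite D" for D
  proof -
    obtain N where N: "\<forall>x\<in>D. x < N" using finite_nat_set_iff_bounded D by auto
    have "D \<subseteq> snd (F N)"
    proof
      fix x assume "x \<in> D"
      then have "Suc x \<le> N" using N by auto
      then show "x \<in> snd (F N)" using mono[of "Suc x" N] dom[of x] by auto
    qed
    moreover have "preserves g (snd (F N))"
      using preserves_cong[of "snd (F N)" g "fst (F N)"] g F(1)[of N] by (auto simp: P_def)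
    ultimately show ?thesis using preserves_subset F(1)[of N] by (auto simp: P_def)
  qed
  have "inj g"
  proof (rule injI)
    fix x y assume "g x = g y"
    moreover have "inj_on g {x, y}" using pres[of "{x, y}"] by (simp add: preserves_def)
    ultimately show "x = y" by (simp add: inj_on_eq_iff)
  qed
  moreover have "surj g"
  proof (unfold surj_def, intro allI)
    fix y
    have "y \<in> fst (F (Suc y)) ` snd (F (Suc y))" using F(1)[of "Suc y"] by (auto simp: P_def)
    then obtain x where "x \<in> snd (F (Suc y))" "y = fst (F (Suc y)) x" by blast
    then have "y = g x" using g by simp
    then show "\<exists>x. y = g x" ..
  qed
  ultimately have "bij g" by (rule bijI)
  moreover have "g x = f x" if "x \<in> S" for x
    using g[of x 0] F(1)[of 0] that by (auto simp: P_def)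
  ultimately show ?thesis using that pres by blast
qed

end

section \<open>Ultrahomogeneous structures as Fraisse limits\<close>

lemma is_embedding_comp:
  assumes "is_embedding f A B" "is_embedding g B C"
  shows "is_embedding (g \<circ> f) A C"
  unfolding is_embedding_def
proof (intro conjI allI impI)
  show "inj_on (g \<circ> f) (univ A)"
    using assms by (auto simp: is_embedding_def intro!: comp_inj_on intro: inj_on_subset)
  show "(g \<circ> f) ` univ A \<subseteq> univ C"
    using assms unfolding is_embedding_def image_comp[symmetric] by (meson image_mono subset_trans)
  fix r xs assume xs: "set xs \<subseteq> univ A"
  then have "set (map f xs) \<subseteq> univ B" using assms(1) by (auto simp: is_embedding_def)
  then have "map f xs \<in> interp B r \<longleftrightarrow> map g (map f xs) \<in> interp C r"
    using assms(2) by (simp only: is_embedding_def)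
  then show "xs \<in> interp A r \<longleftrightarrow> map (g \<circ> f) xs \<in> interp C r"
    using assms(1) xs by (simp add: is_embedding_def)
qed

lemma is_isomorphism_inverse:
  assumes "is_isomorphism f A B"
  shows "is_isomorphism (inv_into (univ A) f) B A"
proof -
  have inj: "inj_on f (univ A)" and im: "f ` univ A = univ B"
    and eq: "\<And>r xs. set xs \<subseteq> univ A \<Longrightarrow> xs \<in> interp A r \<longleftrightarrow> map f xs \<in> interp B r"
    using assms by (auto simp: is_isomorphism_def is_embedding_def)
  let ?g = "inv_into (univ A) f"
  have "ys \<in> interp B r \<longleftrightarrow> map ?g ys \<in> interp A r" if "set ys \<subseteq> univ B" for r ys
  proof -
    have "map f (map ?g ys) = ys"
      using that im by (auto simp: map_idI f_inv_into_f subset_iff)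
    moreover have "set (map ?g ys) \<subseteq> univ A"
      using that im inv_into_into[of _ f "univ A"] by auto
    ultimately show ?thesis using eq[of "map ?g ys" r] by simp
  qed
  moreover have "?g ` univ B = univ A"
    using inj im inv_into_image_cancel[OF inj subset_refl] by simp
  ultimately show ?thesis
    using im by (auto simp: is_isomorphism_def is_embedding_def inj_on_inv_into)
qed

lemma substructure_on_simps [simp]:
  "univ (substructure_on M S) = S"
  "interp (substructure_on M S) r = {xs \<in> interp M r. set xs \<subseteq> S}"
  by (auto simp: substructure_on_def)

lemma is_structure_substructure_on:
  "is_structure ar M \<Longrightarrow> is_structure ar (substructure_on M S)"
  by (auto simp: is_structure_def)

lemma is_embedding_substructure_on:
  "S \<subseteq> univ M \<Longrightarrow> is_embedding (\<lambda>x. x) (substructure_on M S) M"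
  by (auto simp: is_embedding_def)

lemma is_isomorphism_onto_image:
  "is_embedding f A M \<Longrightarrow> is_isomorphism f A (substructure_on M (f ` univ A))"
  by (auto simp: is_isomorphism_def is_embedding_def)

lemma is_embedding_into_substructure:
  "is_embedding f A M \<Longrightarrow> f ` univ A \<subseteq> S \<Longrightarrow> is_embedding f A (substructure_on M S)"
  by (fastforce simp: is_embedding_def)

text \<open>Embeddability into \<open>M\<close>, rather than being a substructure of it, is what
  makes the class closed under isomorphism.\<close>

definition age :: "('r \<Rightarrow> nat) \<Rightarrow> ('r, nat) rel_structure \<Rightarrow> ('r, nat) rel_structure set" where
  "age ar M = {A. is_structure ar A \<and> finite (univ A) \<and> (\<exists>f. is_embedding f A M)}"

lemma substructure_in_age:
  "is_structure ar M \<Longrightarrow> finite S \<Longrightarrow> S \<subseteq> univ M \<Longrightarrow> substructure_on M S \<in> age ar M"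
  unfolding age_def using is_structure_substructure_on is_embedding_substructure_on by fastforce

lemma isomorphic_refl: "isomorphic A A"
  unfolding isomorphic_def
  by (intro exI[of _ "\<lambda>x. x"]) (auto simp: is_isomorphism_def is_embedding_def)

text \<open>Everything takes place inside \<open>M\<close>: joint embedding takes the union of two
  images. For amalgamation, ultrahomogeneity supplies an automorphism moving the image of
  \<open>A\<close> under \<open>e1 \<circ> f\<close> onto its image under
  \<open>e2 \<circ> g\<close>, and the union is taken after that move.\<close>

lemma fraisse_class_age:
  assumes M: "is_structure ar M" "infinite (univ M)" "ultrahomogeneous M"
  shows "fraisse_class ar (age ar M)"
  unfolding fraisse_class_def
proof (intro conjI ballI allI impI)
  show "is_structure ar A" "finite (univ A)" if "A \<in> age ar M" for A
    using that by (auto simp: age_def)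
  show "B \<in> age ar M" if A: "A \<in> age ar M" and B: "is_structure ar B \<and> isomorphic A B" for A B
  proof -
    obtain f where f: "is_isomorphism f A B" using B by (auto simp: isomorphic_def)
    obtain e where e: "is_embedding e A M" using A by (auto simp: age_def)
    have "is_embedding (e \<circ> inv_into (univ A) f) B M"
      using is_embedding_comp[OF _ e] is_isomorphism_inverse[OF f] by (auto simp: is_isomorphism_def)
    moreover have "finite (univ B)"
      using f A unfolding is_isomorphism_def age_def by (metis (mono_tags, lifting) finite_imageI mem_Collect_eq)
    ultimately show ?thesis using B by (auto simp: age_def)
  qed
  show "\<exists>C\<subseteq>age ar M. countable C \<and> (\<forall>A\<in>age ar M. \<exists>B\<in>C. isomorphic A B)"
  proof (intro exI[of _ "substructure_on M ` {S. finite S \<and> S \<subseteq> univ M}"] conjI ballI)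
    show "substructure_on M ` {S. finite S \<and> S \<subseteq> univ M} \<subseteq> age ar M"
      using substructure_in_age[OF M(1)] by auto
    have "countable {S::nat set. finite S}" by (rule countable_Collect_finite)
    then show "countable (substructure_on M ` {S. finite S \<and> S \<subseteq> univ M})"
      by (intro countable_image) (rule countable_subset, auto)
    fix A assume A: "A \<in> age ar M"
    then obtain f where f: "is_embedding f A M" by (auto simp: age_def)
    then show "\<exists>B\<in>substructure_on M ` {S. finite S \<and> S \<subseteq> univ M}. isomorphic A B"
      using is_isomorphism_onto_image[OF f] A
      by (intro bexI[of _ "substructure_on M (f ` univ A)"])
        (auto simp: age_def is_embedding_def isomorphic_def)
  qed
  show "\<exists>A\<in>age ar M. n \<le> card (univ A)" for n
  proof -
    obtain S where "finite S" "card S = n" "S \<subseteq> univ M"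
      using infinite_arbitrarily_large[OF M(2)] by metis
    then show ?thesis
      using substructure_in_age[OF M(1)] by (intro bexI[of _ "substructure_on M S"]) auto
  qed
  show "substructure_on A S \<in> age ar M" if A: "A \<in> age ar M" and S: "S \<subseteq> univ A" for A S
  proof -
    obtain f where "is_embedding f A M" using A by (auto simp: age_def)
    then have "is_embedding (f \<circ> (\<lambda>x. x)) (substructure_on A S) M"
      by (rule is_embedding_comp[OF is_embedding_substructure_on[OF S]])
    then show ?thesis
      using A S is_structure_substructure_on finite_subset by (fastforce simp: age_def)
  qed
  have union: "\<exists>D\<in>age ar M. is_embedding e1 B D \<and> is_embedding e2 C D"
    if "B \<in> age ar M" "C \<in> age ar M" and e: "is_embedding e1 B M" "is_embedding e2 C M" for B C e1 e2
  proof (intro bexI[of _ "substructure_on M (e1 ` univ B \<union> e2 ` univ C)"] conjI)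
    show "substructure_on M (e1 ` univ B \<union> e2 ` univ C) \<in> age ar M"
      using that by (intro substructure_in_age M) (auto simp: age_def is_embedding_def)
  qed (use e in \<open>auto intro: is_embedding_into_substructure\<close>)
  show "\<exists>C\<in>age ar M. \<exists>f g. is_embedding f A C \<and> is_embedding g B C"
    if A: "A \<in> age ar M" and B: "B \<in> age ar M" for A B
  proof -
    obtain e1 e2 where "is_embedding e1 A M" "is_embedding e2 B M" using A B by (auto simp: age_def)
    then show ?thesis using union[OF A B] by blast
  qed
  show "\<exists>D\<in>age ar M. \<exists>h k. is_embedding h B D \<and> is_embedding k C D \<and> (\<forall>a\<in>univ A. h (f a) = k (g a))"
    if A: "A \<in> age ar M" and B: "B \<in> age ar M" and C: "C \<in> age ar M"
      and fg: "is_embedding f A B \<and> is_embedding g A C" for A B C f g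
  proof -
    obtain e1 e2 where e: "is_embedding e1 B M" "is_embedding e2 C M" using B C by (auto simp: age_def)
    let ?f = "e1 \<circ> f" and ?g = "e2 \<circ> g"
    have f: "is_embedding ?f A M" and g: "is_embedding ?g A M"
      using e fg is_embedding_comp by blast+
    let ?S = "?f ` univ A" and ?T = "?g ` univ A"
    let ?i = "inv_into (univ A) ?f"
    have "is_isomorphism ?i (substructure_on M ?S) A"
      using is_isomorphism_inverse[OF is_isomorphism_onto_image[OF f]] .
    then have "is_isomorphism (?g \<circ> ?i) (substructure_on M ?S) (substructure_on M ?T)"
      using is_isomorphism_onto_image[OF g]
      by (auto simp: is_isomorphism_def image_comp[symmetric] simp del: substructure_on_simps(2) o_apply
          intro: is_embedding_comp)
    moreover have "finite ?S" "finite ?T" "?S \<subseteq> univ M" "?T \<subseteq> univ M"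
      using A f g by (auto simp: age_def is_embedding_def)
    ultimately have "\<exists>h\<in>Aut M. \<forall>x\<in>?S. h x = (?g \<circ> ?i) x"
      using M(3)[unfolded ultrahomogeneous_def, rule_format, of ?S ?T "?g \<circ> ?i"] by simp
    then obtain h where h: "h \<in> Aut M" "\<forall>x\<in>?S. h x = (?g \<circ> ?i) x" by blast
    have "h (e1 (f a)) = e2 (g a)" if a: "a \<in> univ A" for a
    proof -
      have inj: "inj_on ?f (univ A)" using f by (simp add: is_embedding_def)
      have "h (?f a) = (?g \<circ> ?i) (?f a)" using h(2) a by blast
      also have "\<dots> = ?g a" using inv_into_f_f[OF inj a] by simp
      finally show ?thesis by simp
    qed
    moreover have "is_embedding (h \<circ> e1) B M"
      using h(1) e(1) by (intro is_embedding_comp) (auto simp: Aut_def is_isomorphism_def)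
    ultimately show ?thesis using union[OF B C _ e(2), of "h \<circ> e1"] by (metis comp_apply)
  qed
qed

lemma fraisse_limit_if_ultrahomogeneous:
  fixes M :: "('r, nat) rel_structure"
  assumes M: "is_structure ar M" "infinite (univ M)" "ultrahomogeneous M"
  shows "fraisse_limit ar M"
  unfolding fraisse_limit_def fraisse_limit_of_def
proof (intro exI[of _ "age ar M"] conjI ballI allI impI)
  show "\<exists>A\<in>age ar M. isomorphic (substructure_on M S) A" if "finite S \<and> S \<subseteq> univ M" for S
    using that substructure_in_age[OF M(1)] isomorphic_refl by blast
  show "\<exists>S. finite S \<and> S \<subseteq> univ M \<and> isomorphic A (substructure_on M S)" if A: "A \<in> age ar M" for A
  proof -
    obtain f where f: "is_embedding f A M" using A by (auto simp: age_def)
    then show ?thesis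
      using is_isomorphism_onto_image[OF f] A
      by (intro exI[of _ "f ` univ A"]) (auto simp: age_def is_embedding_def isomorphic_def)
  qed
qed (use M fraisse_class_age in auto)

section \<open>The structure of a generic law\<close>

definition law_arity :: "nat \<Rightarrow> nat" where
  "law_arity r = fst (from_nat r :: nat \<times> nat \<times> rat)"

text \<open>A symbol coding \<open>(k, j, q)\<close> holds of a tuple of length \<open>k\<close> if
  \<open>q\<close> is the probability that the trace on its entries consists of exactly the entries
  among the first \<open>j\<close>. As \<open>q\<close> is rational, the triples can be coded by
  natural numbers.\<close>

definition law_structure :: "(nat set \<Rightarrow> nat set \<Rightarrow> rat) \<Rightarrow> (nat, nat) rel_structure" where
  "law_structure w = \<lparr>univ = UNIV, interp = (\<lambda>r. case from_nat r of (k, j, q) \<Rightarrow>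
     {xs. length xs = k \<and> w (set xs) (set (take j xs)) = q})\<rparr>"

lemma univ_law_structure [simp]: "univ (law_structure w) = UNIV"
  by (simp add: law_structure_def)

lemma is_structure_law_structure: "is_structure law_arity (law_structure w)"
  by (auto simp: is_structure_def law_structure_def law_arity_def split: prod.splits)

context coherent
begin

lemma is_embedding_law_iff:
  "is_embedding f (substructure_on (law_structure w) S) (substructure_on (law_structure w) T)
    \<longleftrightarrow> inj_on f S \<and> f ` S \<subseteq> T \<and> (\<forall>D\<subseteq>S. finite D \<longrightarrow> preserves f D)" (is "?L \<longleftrightarrow> ?R")
proof
  assume L: ?L
  then have inj: "inj_on f S" and im: "f ` S \<subseteq> T" by (auto simp: is_embedding_def)
  have "preserves f D" if D: "D \<subseteq> S" "finite D" for D
    unfolding preserves_def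
  proof (intro conjI allI impI)
    show "inj_on f D" using inj D(1) inj_on_subset by blast
    fix U assume U: "U \<subseteq> D"
    obtain us where us: "set us = U" using finite_list finite_subset U D by metis
    obtain ds where ds: "set ds = D" using finite_list D by metis
    \<comment> \<open>Listing \<open>U\<close> first and then the whole of \<open>D\<close> lets a
      single relation express \<open>w D U\<close>; repetitions are harmless because only the sets
      of entries enter.\<close>
    let ?r = "to_nat (length (us @ ds), length us, w D U)"
    have UD: "U \<union> D = D" using U by auto
    have fUD: "f ` U \<union> f ` D = f ` D" using U by auto
    have "us @ ds \<in> interp (substructure_on (law_structure w) S) ?r"
      using us ds D U UD by (auto simp: law_structure_def)
    moreover have "set (us @ ds) \<subseteq> S" using us ds D U by auto
    ultimately have "map f (us @ ds) \<in> interp (substructure_on (law_structure w) T) ?r"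
      using L by (simp only: is_embedding_def substructure_on_simps(1))
    then show "w (f ` D) (f ` U) = w D U"
      using us ds UD fUD by (simp add: law_structure_def)
  qed
  then show ?R using inj im by auto
next
  assume R: ?R
  show ?L
    unfolding is_embedding_def substructure_on_simps(1)
  proof (intro conjI allI impI)
    fix r xs assume xs: "set xs \<subseteq> S"
    obtain k j q where r: "from_nat r = (k :: nat, j :: nat, q :: rat)" by (metis prod_cases3)
    have "preserves f (set xs)" using R xs by auto
    then have "w (f ` set xs) (f ` set (take j xs)) = w (set xs) (set (take j xs))"
      by (simp add: preserves_def set_take_subset)
    then show "xs \<in> interp (substructure_on (law_structure w) S) r
        \<longleftrightarrow> map f xs \<in> interp (substructure_on (law_structure w) T) r"
      using xs R by (auto simp: law_structure_def r take_map)
  qed (use R in auto)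
qed

lemma Aut_law_iff: "g \<in> Aut (law_structure w) \<longleftrightarrow> bij g \<and> (\<forall>D. finite D \<longrightarrow> preserves g D)"
proof -
  have "substructure_on (law_structure w) UNIV = law_structure w"
    by (simp add: substructure_on_def law_structure_def)
  then have emb: "is_embedding g (law_structure w) (law_structure w)
      \<longleftrightarrow> inj g \<and> (\<forall>D. finite D \<longrightarrow> preserves g D)"
    using is_embedding_law_iff[of g UNIV UNIV] by simp
  have perm: "g permutes UNIV \<longleftrightarrow> bij g"
    using bij_imp_permutes[of g UNIV] permutes_bij[of g UNIV] by auto
  show ?thesis
    unfolding Aut_def is_isomorphism_def emb univ_law_structure perm mem_Collect_eq bij_def by blast
qed

lemma Aut_invariant:
  assumes "g \<in> Aut (law_structure w)" "finite D" "T \<subseteq> D"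
  shows "w (g ` D) (g ` T) = w D T"
  using assms by (auto simp: Aut_law_iff preserves_def)

lemma Aut_id [simp]: "id \<in> Aut (law_structure w)" "(\<lambda>x. x) \<in> Aut (law_structure w)"
  by (auto simp: Aut_law_iff id_def bij_id[unfolded id_def])

lemma Aut_comp: "g \<in> Aut (law_structure w) \<Longrightarrow> h \<in> Aut (law_structure w) \<Longrightarrow> g \<circ> h \<in> Aut (law_structure w)"
  by (auto simp: Aut_law_iff bij_comp intro: preserves_comp)

lemma Aut_inv:
  assumes "g \<in> Aut (law_structure w)"
  shows "inv_into UNIV g \<in> Aut (law_structure w)"
proof -
  have g: "bij g" "\<And>D. finite D \<Longrightarrow> preserves g D" using assms by (auto simp: Aut_law_iff)
  have "preserves (inv_into UNIV g) D" if D: "finite D" for D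
  proof -
    have "preserves (inv_into UNIV g) (g ` inv_into UNIV g ` D)"
    proof (rule preserves_inverse)
      show "preserves g (inv_into UNIV g ` D)" using g(2) D by blast
      show "inv_into UNIV g (g x) = x" for x
        using g(1) by (simp add: bij_is_inj)
    qed
    moreover have "g ` inv_into UNIV g ` D = D"
      using image_f_inv_f[of g D] g(1) by (simp add: bij_is_surj)
    ultimately show ?thesis by simp
  qed
  then show ?thesis using g(1) by (simp add: Aut_law_iff bij_imp_bij_inv)
qed

end

context generic
begin

lemma preserves_extends_to_Aut:
  assumes "preserves f S" "finite S"
  shows "\<exists>g\<in>Aut (law_structure w). \<forall>x\<in>S. g x = f x"
proof (rule preserves_extends_to_bij[OF assms])
  fix g assume "bij g" "\<And>D. finite D \<Longrightarrow> preserves g D" "\<And>x. x \<in> S \<Longrightarrow> g x = f x"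
  then show ?thesis by (intro bexI[of _ g]) (auto simp: Aut_law_iff)
qed

lemma ultrahomogeneous_law: "ultrahomogeneous (law_structure w)"
  unfolding ultrahomogeneous_def
proof (intro allI impI)
  fix S T f
  assume *: "finite S \<and> S \<subseteq> univ (law_structure w) \<and> finite T \<and> T \<subseteq> univ (law_structure w) \<and>
    is_isomorphism f (substructure_on (law_structure w) S) (substructure_on (law_structure w) T)"
  then have f: "preserves f S" and S: "finite S" by (auto simp: is_isomorphism_def is_embedding_law_iff)
  then show "\<exists>g\<in>Aut (law_structure w). \<forall>a\<in>S. g a = f a"
    by (intro preserves_extends_to_Aut)
qed

lemma fraisse_limit_law: "fraisse_limit law_arity (law_structure w)"
  using is_structure_law_structure ultrahomogeneous_law
  by (intro fraisse_limit_if_ultrahomogeneous) auto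

text \<open>The map that fixes \<open>C\<close> and sends \<open>a\<close> to \<open>b\<close>
  preserves the law by \<open>preserves_insertI\<close>, and homogeneity extends it.\<close>

lemma orbit_eqI:
  assumes C: "finite C" "a \<notin> C" "b \<notin> C"
    and eq: "\<And>X. X \<subseteq> C \<Longrightarrow> w (insert b C) (insert b X) = w (insert a C) (insert a X)"
  obtains g where "g \<in> Aut (law_structure w)" "\<And>x. x \<in> C \<Longrightarrow> g x = x" "g a = b"
proof -
  define f where "f x = (if x = a then b else x)" for x
  have fix_C: "f x = x" if "x \<in> C" for x using that C by (auto simp: f_def)
  have im: "f ` T = T" if T: "T \<subseteq> C" for T
  proof -
    have "f ` T = (\<lambda>x. x) ` T" using T fix_C by (intro image_cong) auto
    then show ?thesis by simp
  qed
  have "preserves f (insert a C)"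
  proof (rule preserves_insertI[OF _ C(1,2)])
    have "preserves f C \<longleftrightarrow> preserves (\<lambda>x. x) C"
      by (rule preserves_cong) (rule fix_C)
    then show "preserves f C" by simp
    show "f a = b" by (simp add: f_def)
  qed (use C im eq in simp_all)
  then obtain g where g: "g \<in> Aut (law_structure w)" "\<forall>x\<in>insert a C. g x = f x"
    using preserves_extends_to_Aut C(1) by blast
  show ?thesis
  proof (rule that[OF g(1)])
    show "g x = x" if "x \<in> C" for x using g(2) that fix_C by simp
    show "g a = b" using g(2) by (simp add: f_def)
  qed
qed

lemma transitive_law: "transitive_structure (law_structure w)"
  unfolding transitive_structure_def
proof (intro ballI)
  fix a b
  show "\<exists>g\<in>Aut (law_structure w). g a = b"
    by (rule orbit_eqI[of "{}" a b]) (auto simp: half)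
qed

text \<open>If an orbit were finite, \<open>ext_avoid\<close> would realise the same type outside
  it.\<close>

lemma no_algebraicity_law: "no_algebraicity (law_structure w)"
  unfolding no_algebraicity_def
proof (intro allI impI notI)
  fix as and x :: nat
  let ?O = "(\<lambda>g. g x) ` tuple_stabilizer (law_structure w) as"
  assume x: "set as \<subseteq> univ (law_structure w) \<and> x \<in> univ (law_structure w) \<and> x \<notin> set as"
    and fin: "finite ?O"
  have as: "finite (set as)" "x \<notin> set as" using x by auto
  obtain b where b: "b \<notin> set as" "b \<notin> ?O"
    "\<And>T. T \<subseteq> set as \<Longrightarrow> w (insert b (set as)) (insert b T) = w (insert x (set as)) (insert x T)"
    by (rule ext_avoid[OF as(1) fin, of "\<lambda>T. w (insert x (set as)) (insert x T)"])
      (use new_point_bounds[OF as] sum_new_point[OF as] in auto)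
  obtain g where "g \<in> Aut (law_structure w)" "\<And>y. y \<in> set as \<Longrightarrow> g y = y" "g x = b"
    using orbit_eqI[OF as b(1,3)] by blast
  then have "b \<in> ?O" by (force simp: tuple_stabilizer_def)
  then show False using b(2) by simp
qed

end

lemma image_fixed: "(\<And>x. x \<in> X \<Longrightarrow> f x = x) \<Longrightarrow> f ` X = X"
  using image_cong[of X X f "\<lambda>x. x"] by simp

section \<open>Supports of subgroups\<close>

context generic
begin

text \<open>
  Call \<open>b\<close> near \<open>a\<close> if it has the type of \<open>a\<close> over \<open>C\<close> and disagrees with \<open>a\<close> with small probability.
  A point close enough to \<open>a\<close> over \<open>C\<close> can be moved within its type over \<open>C \<union> {a}\<close> to a
  point having the type of \<open>a\<close> over \<open>D\<close>, which the stabiliser of \<open>D\<close> reaches from \<open>a\<close>.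
  A randomised midpoint between \<open>a\<close> and \<open>b\<close>, copying either of them with equal probability,
  then shows that the threshold can be increased by a factor.
\<close>

lemma stabilizer_reduce:
  assumes V: "\<And>g h. g \<in> V \<Longrightarrow> h \<in> V \<Longrightarrow> g \<circ> h \<in> V" "\<And>g. g \<in> V \<Longrightarrow> inv_into UNIV g \<in> V"
      "V \<subseteq> Aut (law_structure w)"
    and D: "finite D" "C \<subseteq> D" "a \<notin> D"
    and stab_a: "\<And>g. g \<in> Aut (law_structure w) \<Longrightarrow> (\<And>x. x \<in> insert a C \<Longrightarrow> g x = x) \<Longrightarrow> g \<in> V"
    and stab_D: "\<And>g. g \<in> Aut (law_structure w) \<Longrightarrow> (\<And>x. x \<in> D \<Longrightarrow> g x = x) \<Longrightarrow> g \<in> V"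
    and g: "g \<in> Aut (law_structure w)" "\<And>x. x \<in> C \<Longrightarrow> g x = x"
  shows "g \<in> V"
proof -
  have C: "finite C" "a \<notin> C" using D finite_subset by auto
  define p where "p X = w (insert a C) (insert a X)" for X
  \<comment> \<open>The difference bounded by \<open>\<theta>\<close> is the probability of the
    pattern \<open>X\<close> on \<open>C\<close> with \<open>a\<close> inside and \<open>b\<close>
    outside the random set.\<close>
  define near where "near \<theta> b \<longleftrightarrow> b \<notin> insert a C \<and>
    (\<forall>X\<subseteq>C. w (insert b C) (insert b X) = p X \<and>
      p X - w (insert b (insert a C)) (insert b (insert a X)) < \<theta>)" for \<theta> b
  define reach where "reach b \<longleftrightarrow> (\<exists>h\<in>V. (\<forall>x\<in>C. h x = x) \<and> h a = b)" for b
  \<comment> \<open>Since \<open>a\<close> and \<open>b\<close> have the same type over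
    \<open>C\<close>, the two kinds of disagreement are equally probable. The type of the pair over
    \<open>C\<close> is thus determined by the probabilities that both points are inside.\<close>
  have offdiag: "w (insert b (insert a C)) (insert b X) = p X - w (insert b (insert a C)) (insert b (insert a X))"
      "w (insert b (insert a C)) (insert a X) = p X - w (insert b (insert a C)) (insert b (insert a X))"
      "0 < p X - w (insert b (insert a C)) (insert b (insert a X))"
    if b: "near \<theta> b" and X: "X \<subseteq> C" for \<theta> b X
  proof -
    have b': "b \<notin> insert a C" "w (insert b C) (insert b X) = p X" using b X by (auto simp: near_def)
    have "w (insert b C) (insert b X)
      = w (insert a (insert b C)) (insert b X) + w (insert a (insert b C)) (insert a (insert b X))"
      by (rule split) (use C b' X in auto)
    then show 1: "w (insert b (insert a C)) (insert b X) = p X - w (insert b (insert a C)) (insert b (insert a X))"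
      using b' by (simp add: insert_commute)
    have "w (insert a C) (insert a X)
      = w (insert b (insert a C)) (insert a X) + w (insert b (insert a C)) (insert b (insert a X))"
      by (rule split) (use C b' X in auto)
    then show "w (insert b (insert a C)) (insert a X) = p X - w (insert b (insert a C)) (insert b (insert a X))"
      by (simp add: p_def)
    have "0 < w (insert b (insert a C)) (insert b X)" by (rule pos) (use C X in auto)
    then show "0 < p X - w (insert b (insert a C)) (insert b (insert a X))" using 1 by simp
  qed

  have "\<exists>\<eta>>0. \<forall>b. near \<eta> b \<longrightarrow> reach b"
  proof -
    \<comment> \<open>This is the least probability of a pattern on \<open>insert a D\<close>: any
      smaller amount can be taken off each pattern and still leave positive mass.\<close>
    define \<eta> where "\<eta> = Min ((\<lambda>Y. min (w (insert a D) (insert a Y)) (w (insert a D) Y)) ` Pow D)"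
    have \<eta>_pos: "0 < \<eta>"
      unfolding \<eta>_def using D by (subst Min_gr_iff) (auto intro!: pos)
    have "\<eta> \<le> min (w (insert a D) (insert a Y)) (w (insert a D) Y)" if "Y \<subseteq> D" for Y
      unfolding \<eta>_def using D that by (intro Min_le) auto
    then have \<eta>_le: "\<eta> \<le> w (insert a D) (insert a Y)" "\<eta> \<le> w (insert a D) Y" if "Y \<subseteq> D" for Y
      using that by simp_all
    have "reach b" if b: "near \<eta> b" for b
    proof -
      define \<delta> where "\<delta> X = p X - w (insert b (insert a C)) (insert b (insert a X))" for X
      have \<delta>: "0 < \<delta> X" "\<delta> X < \<eta>" if "X \<subseteq> C" for X
        using offdiag(3)[OF b that] b that by (auto simp: \<delta>_def near_def)
      \<comment> \<open>The disagreement wanted over \<open>C\<close> is spread over the patterns of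
        \<open>D\<close> in proportion to their conditional probabilities, so that it sums back to
        \<open>\<delta>\<close> over each pattern of \<open>C\<close>.\<close>
      define \<tau> where "\<tau> Y = \<delta> (Y \<inter> C) * w D Y / w C (Y \<inter> C)" for Y
      have \<tau>: "0 < \<tau> Y" "\<tau> Y < \<eta>" if Y: "Y \<subseteq> D" for Y
      proof -
        have wD: "0 < w D Y" and wC: "0 < w C (Y \<inter> C)" using pos D C Y by auto
        have d: "0 < \<delta> (Y \<inter> C)" "\<delta> (Y \<inter> C) < \<eta>" using \<delta>[of "Y \<inter> C"] by auto
        show "0 < \<tau> Y" using wD wC d by (simp add: \<tau>_def)
        have "\<delta> (Y \<inter> C) * w D Y \<le> \<delta> (Y \<inter> C) * w C (Y \<inter> C)"
          using marginal_le[OF D(1,2) Y] d by (intro mult_left_mono) auto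
        then have "\<tau> Y \<le> \<delta> (Y \<inter> C)" using wC by (simp add: \<tau>_def pos_divide_le_eq)
        then show "\<tau> Y < \<eta>" using d by simp
      qed
      \<comment> \<open>The new point \<open>c\<close> copies \<open>a\<close>, except that mass
        \<open>\<tau>\<close> is exchanged equally in both directions. The exchange cancels over
        \<open>D\<close>, where \<open>c\<close> has the type of \<open>a\<close>; over
        \<open>insert a C\<close> it gives \<open>c\<close> the type of \<open>b\<close>.\<close>
      define v where "v Z = (if a \<in> Z then w (insert a D) Z - \<tau> (Z - {a}) else \<tau> Z)" for Z
      have v: "v Y = \<tau> Y" "v (insert a Y) = w (insert a D) (insert a Y) - \<tau> Y" if "Y \<subseteq> D" for Y
      proof -
        have "a \<notin> Y" using that D by auto
        then show "v Y = \<tau> Y" "v (insert a Y) = w (insert a D) (insert a Y) - \<tau> Y"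
          by (auto simp: v_def)
      qed
      have "\<exists>c. c \<notin> insert a D \<and> (\<forall>Z\<subseteq>insert a D. w (insert c (insert a D)) (insert c Z) = v Z)"
      proof (rule ext)
        show "finite (insert a D)" using D by simp
        fix Z assume Z: "Z \<subseteq> insert a D"
        show "0 < v Z \<and> v Z < w (insert a D) Z"
        proof (cases "a \<in> Z")
          case True
          then have "Z = insert a (Z - {a})" "Z - {a} \<subseteq> D" using Z by auto
          then show ?thesis using v(2)[of "Z - {a}"] \<tau>[of "Z - {a}"] \<eta>_le(1)[of "Z - {a}"] by simp
        next
          case False
          then have "Z \<subseteq> D" using Z by auto
          then show ?thesis using v(1)[of Z] \<tau>[of Z] \<eta>_le(2)[of Z] by simp
        qed
      next
        have "(\<Sum>Z\<in>Pow (insert a D). v Z) = (\<Sum>Y\<in>Pow D. w (insert a D) (insert a Y))"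
          unfolding sum_Pow_insert[OF D(1,3)] by (rule sum.cong) (auto simp: v)
        then show "(\<Sum>Z\<in>Pow (insert a D). v Z) = 1/2" using sum_new_point[OF D(1,3)] by simp
      qed
      then obtain c where c: "c \<notin> insert a D"
        "\<And>Z. Z \<subseteq> insert a D \<Longrightarrow> w (insert c (insert a D)) (insert c Z) = v Z" by blast
      have "w (insert c D) (insert c Y) = w (insert a D) (insert a Y)" if Y: "Y \<subseteq> D" for Y
      proof -
        have "w (insert c D) (insert c Y)
          = w (insert a (insert c D)) (insert c Y) + w (insert a (insert c D)) (insert a (insert c Y))"
          by (rule split) (use D c Y in auto)
        also have "\<dots> = v Y + v (insert a Y)"
          using c(2)[of Y] c(2)[of "insert a Y"] Y subset_insertI2[OF Y, of a] by (simp add: insert_commute)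
        finally show ?thesis using v[OF Y] by simp
      qed
      then obtain h where h: "h \<in> Aut (law_structure w)" "\<And>x. x \<in> D \<Longrightarrow> h x = x" "h a = c"
        using orbit_eqI[of D a c] D c(1) by auto
      have hC: "h ` X = X" if "X \<subseteq> C" for X
        using h(2) that D(2) by (intro image_fixed) auto
      have cC: "w (insert c C) (insert c X) = p X" if X: "X \<subseteq> C" for X
      proof -
        have "w (h ` insert a C) (h ` insert a X) = w (insert a C) (insert a X)"
          by (rule Aut_invariant[OF h(1)]) (use C X in auto)
        then show ?thesis using hC X h(3) by (simp add: p_def)
      qed
      have c_off: "w (insert c (insert a C)) (insert c X) = \<delta> X" if X: "X \<subseteq> C" for X
      proof -
        have eq: "{Z\<in>Pow (insert a D). Z \<inter> insert a C = X} = {Y\<in>Pow D. Y \<inter> C = X}"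
          using X C D by auto
        have "w (insert c (insert a C)) (insert c X)
          = (\<Sum>Y\<in>{Y\<in>Pow D. Y \<inter> C = X}. w (insert c (insert a D)) (insert c Y))"
          unfolding eq[symmetric] by (rule marginal_insert) (use D X c in auto)
        also have "\<dots> = (\<Sum>Y\<in>{Y\<in>Pow D. Y \<inter> C = X}. \<delta> X / w C X * w D Y)"
        proof (rule sum.cong[OF refl])
          fix Y assume Y: "Y \<in> {Y\<in>Pow D. Y \<inter> C = X}"
          then have "w (insert c (insert a D)) (insert c Y) = \<tau> Y" using c(2)[of Y] v(1)[of Y] by auto
          then show "w (insert c (insert a D)) (insert c Y) = \<delta> X / w C X * w D Y"
            using Y by (simp add: \<tau>_def)
        qed
        also have "\<dots> = \<delta> X / w C X * w C X"
          using marginal[OF D(1,2) X] by (simp add: sum_distrib_left)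
        also have "\<dots> = \<delta> X" using pos[OF C(1) X] by simp
        finally show ?thesis .
      qed
      have "w (insert b (insert a C)) (insert b Z) = w (insert c (insert a C)) (insert c Z)"
        if Z: "Z \<subseteq> insert a C" for Z
      proof (cases "a \<in> Z")
        case True
        define X where "X = Z - {a}"
        have X: "X \<subseteq> C" "Z = insert a X" using True Z by (auto simp: X_def)
        have "w (insert c C) (insert c X)
          = w (insert a (insert c C)) (insert c X) + w (insert a (insert c C)) (insert a (insert c X))"
          by (rule split) (use C c D X in auto)
        then have "w (insert c (insert a C)) (insert c Z) = p X - \<delta> X"
          using cC[OF X(1)] c_off[OF X(1)] X(2) by (simp add: insert_commute)
        then show ?thesis using X(2) by (simp add: \<delta>_def)
      next
        case False
        then have "Z \<subseteq> C" using Z by auto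
        then show ?thesis using c_off offdiag(1)[OF b] by (simp add: \<delta>_def)
      qed
      then obtain k where k: "k \<in> Aut (law_structure w)" "\<And>x. x \<in> insert a C \<Longrightarrow> k x = x" "k c = b"
        using orbit_eqI[of "insert a C" c b] C c(1) b D(2) by (auto simp: near_def)
      have "k \<circ> h \<in> V" using V(1) stab_a[OF k(1,2)] stab_D[OF h(1,2)] by blast
      moreover have "(k \<circ> h) x = x" if "x \<in> C" for x using h(2) k(2) that D(2) by auto
      ultimately show ?thesis unfolding reach_def using h(3) k(3) by (intro bexI[of _ "k \<circ> h"]) auto
    qed
    then show ?thesis using \<eta>_pos by blast
  qed
  then obtain \<eta> where \<eta>: "0 < \<eta>" "\<And>b. near \<eta> b \<Longrightarrow> reach b" by blast

  have step: "reach b" if \<theta>: "0 < \<theta>" "\<And>b. near \<theta> b \<Longrightarrow> reach b" and b: "near (3/2 * \<theta>) b" for \<theta> b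
  proof -
    define S where "S = insert b (insert a C)"
    have bC: "b \<notin> insert a C" using b by (simp add: near_def)
    have S: "finite S" using C by (simp add: S_def)
    define r where "r X = w S (insert b (insert a X))" for X
    \<comment> \<open>The midpoint will disagree with either end, over each pattern \<open>X\<close>
      of \<open>C\<close>, with probability \<open>(p X - r X) / 2 + \<epsilon>\<close>, which is
      below \<open>3/4 * \<theta> + \<theta>/4\<close>. This explains the factor \<open>3/2\<close>
      and the bound \<open>\<theta>/4\<close>; the other bounds on \<open>\<epsilon>\<close> give
      every pattern of the midpoint positive probability.\<close>
    define \<epsilon> where "\<epsilon> = Min (insert (\<theta>/4) ((\<lambda>X. min (w S X) (r X)) ` Pow C)) / 2"
    have "0 < Min (insert (\<theta>/4) ((\<lambda>X. min (w S X) (r X)) ` Pow C))"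
      using \<theta> C by (subst Min_gr_iff) (auto intro!: pos simp: r_def S_def)
    then have \<epsilon>_less: "\<epsilon> < Min (insert (\<theta>/4) ((\<lambda>X. min (w S X) (r X)) ` Pow C))" and \<epsilon>_pos: "0 < \<epsilon>"
      by (auto simp: \<epsilon>_def)
    have \<epsilon>_\<theta>: "\<epsilon> < \<theta> / 4" and "\<And>X. X \<subseteq> C \<Longrightarrow> \<epsilon> < min (w S X) (r X)"
      using \<epsilon>_less C by (subst (asm) Min_gr_iff; auto)+
    then have \<epsilon>: "\<epsilon> < w S X" "\<epsilon> < r X" if "X \<subseteq> C" for X using that by simp_all
    have off: "w S (insert b X) = p X - r X" "w S (insert a X) = p X - r X" "0 < p X - r X"
        "p X - r X < 3/2 * \<theta>" "w (insert b C) (insert b X) = p X" if "X \<subseteq> C" for X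
      using offdiag[OF b that] b that by (auto simp: S_def r_def near_def)
    \<comment> \<open>Where \<open>a\<close> and \<open>b\<close> disagree, the midpoint tosses a
      fair coin. Where they agree it copies them up to mass \<open>\<epsilon>\<close>, which is
      moved in both directions to keep the total at \<open>p X\<close>.\<close>
    define v where "v Z = (if a \<in> Z \<and> b \<in> Z then w S Z - \<epsilon> else if a \<in> Z \<or> b \<in> Z then w S Z / 2 else \<epsilon>)" for Z
    have v: "v X = \<epsilon>" "v (insert a X) = (p X - r X) / 2" "v (insert b X) = (p X - r X) / 2"
      "v (insert b (insert a X)) = r X - \<epsilon>" if "X \<subseteq> C" for X
    proof -
      have "a \<notin> X" "b \<notin> X" "a \<noteq> b" using that C bC by auto
      then show "v X = \<epsilon>" "v (insert a X) = (p X - r X) / 2" "v (insert b X) = (p X - r X) / 2"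
          "v (insert b (insert a X)) = r X - \<epsilon>"
        using off[OF that] by (auto simp: v_def r_def)
    qed
    have "\<exists>m. m \<notin> S \<and> (\<forall>Z\<subseteq>S. w (insert m S) (insert m Z) = v Z)"
    proof (rule ext[OF S])
      fix Z assume Z: "Z \<subseteq> S"
      have 0: "0 < w S Z" by (rule pos[OF S Z])
      define X where "X = Z - {a, b}"
      have X: "X \<subseteq> C" using Z by (auto simp: X_def S_def)
      consider "Z = insert b (insert a X)" | "(a \<in> Z \<or> b \<in> Z) \<and> \<not> (a \<in> Z \<and> b \<in> Z)" | "Z = X"
        by (auto simp: X_def)
      then show "0 < v Z \<and> v Z < w S Z"
      proof cases
        case 1
        then show ?thesis using v(4)[OF X] \<epsilon>[OF X] \<epsilon>_pos by (simp add: r_def)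
      next
        case 2
        then show ?thesis using 0 by (auto simp: v_def)
      next
        case 3
        then show ?thesis using v(1)[OF X] \<epsilon>[OF X] \<epsilon>_pos by simp
      qed
    next
      have fin: "finite (insert a C)" using C by simp
      have "(\<Sum>Z\<in>Pow S. v Z) = (\<Sum>X\<in>Pow C. p X)"
        unfolding S_def sum_Pow_insert[OF fin bC] sum_Pow_insert[OF C]
        by (rule sum.cong) (auto simp: v)
      then show "(\<Sum>Z\<in>Pow S. v Z) = 1/2" using sum_new_point[OF C] by (simp add: p_def)
    qed
    then obtain m where m: "m \<notin> S" "\<And>Z. Z \<subseteq> S \<Longrightarrow> w (insert m S) (insert m Z) = v Z" by blast
    have ma: "w (insert m (insert a C)) (insert m Z) = v Z + v (insert b Z)" if Z: "Z \<subseteq> insert a C" for Z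
    proof -
      have "w (insert m (insert a C)) (insert m Z) = w (insert b (insert m (insert a C))) (insert m Z)
        + w (insert b (insert m (insert a C))) (insert b (insert m Z))"
        by (rule split) (use C bC m Z in \<open>auto simp: S_def\<close>)
      also have "\<dots> = w (insert m S) (insert m Z) + w (insert m S) (insert m (insert b Z))"
        by (simp add: S_def insert_commute)
      also have "\<dots> = v Z + v (insert b Z)"
      proof -
        have "Z \<subseteq> S" "insert b Z \<subseteq> S" using Z by (auto simp: S_def)
        then show ?thesis by (simp only: m(2))
      qed
      finally show ?thesis .
    qed
    have near_m: "near \<theta> m"
      unfolding near_def
    proof (intro conjI allI impI)
      show "m \<notin> insert a C" using m(1) by (auto simp: S_def)
      fix X assume X: "X \<subseteq> C"
      have "w (insert m C) (insert m X)
        = w (insert a (insert m C)) (insert m X) + w (insert a (insert m C)) (insert a (insert m X))"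
        by (rule split) (use C m X in \<open>auto simp: S_def\<close>)
      also have "\<dots> = w (insert m (insert a C)) (insert m X) + w (insert m (insert a C)) (insert m (insert a X))"
        by (simp add: insert_commute)
      also have "\<dots> = (v X + v (insert b X)) + (v (insert a X) + v (insert b (insert a X)))"
        using X by (subst (1 2) ma) auto
      also have "\<dots> = p X" using v[OF X] by (simp add: field_simps)
      finally show "w (insert m C) (insert m X) = p X" .
      show "p X - w (insert m (insert a C)) (insert m (insert a X)) < \<theta>"
        using ma[OF Set.insert_mono[OF X]] v[OF X] off(4)[OF X] \<epsilon>_\<theta> by (simp add: field_simps)
    qed
    then obtain h where h: "h \<in> V" "\<And>x. x \<in> C \<Longrightarrow> h x = x" "h a = m"
      using \<theta>(2) by (auto simp: reach_def)
    have hA: "h \<in> Aut (law_structure w)" using h V by auto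
    then have "bij h" by (simp add: Aut_law_iff)
    \<comment> \<open>The pair of \<open>a\<close> and \<open>b'\<close> has the type of the pair of
      \<open>m\<close> and \<open>b\<close> over \<open>C\<close>, so \<open>b'\<close> is as near
      to \<open>a\<close> as \<open>b\<close> is to \<open>m\<close>. A move from \<open>a\<close>
      to \<open>b'\<close> followed by \<open>h\<close> then reaches \<open>b\<close>.\<close>
    then obtain b' where b': "h b' = b" by (metis bij_pointE)
    have hC: "h ` X = X" if "X \<subseteq> C" for X
      using h(2) that by (intro image_fixed) auto
    have "near \<theta> b'"
      unfolding near_def
    proof (intro conjI allI impI)
      show "b' \<notin> insert a C"
        using b' h(2,3) bC m(1) by (auto simp: S_def)
      fix X assume X: "X \<subseteq> C"
      have "w (h ` insert b' C) (h ` insert b' X) = w (insert b' C) (insert b' X)"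
        by (rule Aut_invariant[OF hA]) (use C X in auto)
      then show "w (insert b' C) (insert b' X) = p X" using hC X b' off(5)[OF X] by simp
      have "w (h ` insert b' (insert a C)) (h ` insert b' (insert a X))
          = w (insert b' (insert a C)) (insert b' (insert a X))"
        by (rule Aut_invariant[OF hA]) (use C X in auto)
      then have "w (insert b' (insert a C)) (insert b' (insert a X)) = w (insert b (insert m C)) (insert b (insert m X))"
        using hC X b' h(3) by simp
      also have "\<dots> = w (insert a (insert b (insert m C))) (insert b (insert m X))
        + w (insert a (insert b (insert m C))) (insert a (insert b (insert m X)))"
        by (rule split) (use C bC m X in \<open>auto simp: S_def\<close>)
      also have "\<dots> = w (insert m S) (insert m (insert b X)) + w (insert m S) (insert m (insert b (insert a X)))"
        by (simp add: S_def insert_commute)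
      also have "\<dots> = v (insert b X) + v (insert b (insert a X))"
      proof -
        have "insert b X \<subseteq> S" "insert b (insert a X) \<subseteq> S" using X by (auto simp: S_def)
        then show ?thesis by (simp only: m(2))
      qed
      finally show "p X - w (insert b' (insert a C)) (insert b' (insert a X)) < \<theta>"
        using v[OF X] off(4)[OF X] \<epsilon>_\<theta> by (simp add: field_simps)
    qed
    then obtain k where k: "k \<in> V" "\<And>x. x \<in> C \<Longrightarrow> k x = x" "k a = b'"
      using \<theta>(2) by (auto simp: reach_def)
    show ?thesis
      unfolding reach_def using h k b' V(1)[OF h(1) k(1)] by (intro bexI[of _ "h \<circ> k"]) auto
  qed

  have iter: "near ((3/2)^n * \<eta>) b \<Longrightarrow> reach b" for n b
  proof (induction n arbitrary: b)
    case 0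
    then show ?case using \<eta> by simp
  next
    case (Suc n)
    have "near (3/2 * ((3/2)^n * \<eta>)) b" using Suc.prems by (simp add: mult.assoc)
    then show ?case using step[of "(3/2)^n * \<eta>" b] Suc.IH \<eta>(1) by simp
  qed
  have gpres: "w (insert (g a) C) (insert (g a) X) = p X" if X: "X \<subseteq> C" for X
  proof -
    have "g ` Y = Y" if "Y \<subseteq> C" for Y
      using g(2) that by (intro image_fixed) auto
    moreover have "w (g ` insert a C) (g ` insert a X) = w (insert a C) (insert a X)"
      by (rule Aut_invariant[OF g(1)]) (use C X in auto)
    ultimately show ?thesis using X by (simp add: p_def)
  qed
  have bij_g: "bij g" using g(1) by (simp add: Aut_law_iff)
  show "g \<in> V"
  proof (cases "g a = a")
    case True
    then show ?thesis using stab_a[OF g(1)] g(2) by auto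
  next
    case False
    have gaC: "g a \<notin> insert a C"
      using False g(2) C(2) bij_g by (metis bij_pointE insert_iff)
    \<comment> \<open>Disagreement probabilities are below 1, so a threshold above 1 covers every
      point other than \<open>a\<close> that has its type over \<open>C\<close>.\<close>
    obtain n where n: "1 / \<eta> < (3/2 :: rat)^n"
    proof -
      obtain n where "(1 / \<eta> - 1) / (1/2) < of_nat n" using reals_Archimedean2 by blast
      then have "1 / \<eta> < 1 + of_nat n * (1/2)" by (simp add: field_simps)
      also have "\<dots> \<le> (1 + 1/2)^n" by (rule Bernoulli_inequality) simp
      finally show thesis using that[of n] by simp
    qed
    have "near ((3/2)^n * \<eta>) (g a)"
      unfolding near_def
    proof (intro conjI allI impI gaC gpres)
      fix X assume X: "X \<subseteq> C"
      have "p X < w C X" unfolding p_def by (rule new_point_bounds[OF C X])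
      also have "w C X \<le> 1" using marginal_le[OF C(1) _ X, of "{}"] total by simp
      finally have "p X < 1" .
      moreover have "0 < w (insert (g a) (insert a C)) (insert (g a) (insert a X))"
        by (rule pos) (use C X in auto)
      moreover have "1 < (3/2)^n * \<eta>" using n \<eta>(1) by (simp add: field_simps)
      ultimately show "p X - w (insert (g a) (insert a C)) (insert (g a) (insert a X)) < (3/2)^n * \<eta>"
        by linarith
    qed
    then have "reach (g a)" by (rule iter)
    then obtain h where h: "h \<in> V" "\<And>x. x \<in> C \<Longrightarrow> h x = x" "h a = g a"
      by (auto simp: reach_def)
    have bij_h: "bij h" using h(1) V(3) by (auto simp: Aut_law_iff)
    let ?i = "inv_into UNIV h"
    have ih: "?i (h x) = x" for x using bij_h by (simp add: bij_is_inj)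
    have "?i \<circ> g \<in> V"
    proof (rule stab_a)
      show "?i \<circ> g \<in> Aut (law_structure w)"
        by (rule Aut_comp[OF _ g(1)]) (use V h(1) in blast)
      show "(?i \<circ> g) x = x" if "x \<in> insert a C" for x
        using that ih[of x] g(2) h(2,3) by auto
    qed
    then have "h \<circ> (?i \<circ> g) \<in> V" using V(1) h(1) by blast
    moreover have "h \<circ> (?i \<circ> g) = g"
      using bij_h by (simp add: fun_eq_iff bij_is_surj surj_f_inv_f)
    ultimately show ?thesis by simp
  qed
qed

end

section \<open>Weak elimination of imaginaries\<close>

context coherent
begin

lemma group_aut_group: "group (aut_group (law_structure w))"
proof (rule groupI)
  fix g assume "g \<in> carrier (aut_group (law_structure w))"
  then have g: "g \<in> Aut (law_structure w)" by (simp add: aut_group_def)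
  then have "inv_into UNIV g \<circ> g = id" by (simp add: Aut_law_iff bij_is_inj)
  then show "\<exists>h\<in>carrier (aut_group (law_structure w)).
      h \<otimes>\<^bsub>aut_group (law_structure w)\<^esub> g = \<one>\<^bsub>aut_group (law_structure w)\<^esub>"
    using Aut_inv[OF g] by (auto simp: aut_group_def)
qed (auto simp: aut_group_def Aut_comp)

lemma aut_group_inv:
  assumes "g \<in> Aut (law_structure w)"
  shows "m_inv (aut_group (law_structure w)) g = inv_into UNIV g"
proof (rule group.inv_equality[OF group_aut_group])
  have "inv_into UNIV g \<circ> g = id" using assms by (simp add: Aut_law_iff bij_is_inj)
  then show "inv_into UNIV g \<otimes>\<^bsub>aut_group (law_structure w)\<^esub> g = \<one>\<^bsub>aut_group (law_structure w)\<^esub>"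
    by (simp add: aut_group_def)
qed (use assms Aut_inv in \<open>auto simp: aut_group_def\<close>)

text \<open>A basic neighbourhood of the identity restricts only finitely many coordinates, and
  these form a support.\<close>

lemma open_subgroup_support:
  assumes "openin (aut_topology (law_structure w)) V" "id \<in> V"
  obtains A where "finite A"
    "\<And>g. g \<in> Aut (law_structure w) \<Longrightarrow> (\<And>x. x \<in> A \<Longrightarrow> g x = x) \<Longrightarrow> g \<in> V"
proof -
  obtain W where W: "openin (product_topology (\<lambda>_. discrete_topology UNIV) UNIV) W"
      "V = W \<inter> Aut (law_structure w)"
    using assms(1) by (auto simp: aut_topology_def openin_subtopology)
  then obtain U where U: "finite {i. U i \<noteq> UNIV}" "id \<in> PiE UNIV U" "PiE UNIV U \<subseteq> W"
    using assms(2) unfolding openin_product_topology_alt by fastforce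
  show ?thesis
  proof (rule that[OF U(1)])
    fix g assume g: "g \<in> Aut (law_structure w)" "\<And>x. x \<in> {i. U i \<noteq> UNIV} \<Longrightarrow> g x = x"
    have "g i \<in> U i" for i
      using g(2)[of i] U(2) by (cases "U i = UNIV") (auto simp: PiE_iff)
    then show "g \<in> V" using U(3) W(2) g(1) by (auto simp: PiE_iff)
  qed
qed

end

context generic
begin

text \<open>A support \<open>A\<close> of least size is invariant under \<open>V\<close>: the image
  of \<open>A\<close> under \<open>g\<close> in \<open>V\<close> is again a support, by conjugation,
  so a point of \<open>A\<close> outside it could be dropped by \<open>stabilizer_reduce\<close>.
  Hence \<open>V\<close> acts on the finite set \<open>A\<close>, and the pointwise stabiliser is
  the kernel of this action.\<close>

lemma weak_elimination_law: "weak_elimination_of_imaginaries (law_structure w)"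
  unfolding weak_elimination_of_imaginaries_def
proof (intro allI impI)
  let ?G = "aut_group (law_structure w)"
  fix V
  assume "subgroup V ?G \<and> V \<noteq> carrier ?G \<and> openin (aut_topology (law_structure w)) V"
  then have sub: "subgroup V ?G" and op: "openin (aut_topology (law_structure w)) V" by auto
  have VG: "V \<subseteq> Aut (law_structure w)"
    using subgroup.subset[OF sub] by (simp add: aut_group_def)
  have Vcomp: "g \<circ> h \<in> V" if "g \<in> V" "h \<in> V" for g h
    using subgroup.m_closed[OF sub that] by (simp add: aut_group_def)
  have Vinv: "inv_into UNIV g \<in> V" if "g \<in> V" for g
    using subgroup.m_inv_closed[OF sub that] aut_group_inv that VG by auto
  have Vid: "id \<in> V" using subgroup.one_closed[OF sub] by (simp add: aut_group_def)
  define supp where "supp A \<longleftrightarrow> finite A \<and>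
    (\<forall>g\<in>Aut (law_structure w). (\<forall>x\<in>A. g x = x) \<longrightarrow> g \<in> V)" for A
  obtain A0 where "supp A0" using open_subgroup_support[OF op Vid] by (metis supp_def)
  then obtain A where A: "supp A" "\<And>B. supp B \<Longrightarrow> card A \<le> card B"
    using ex_has_least_nat[of supp A0 card] by blast
  have fA: "finite A" using A by (simp add: supp_def)
  have stab: "g ` A = A" if g: "g \<in> V" for g
  proof (rule ccontr)
    assume ne: "g ` A \<noteq> A"
    have bij: "bij g" using g VG by (auto simp: Aut_law_iff)
    have "card (g ` A) = card A" using bij by (intro card_image) (simp add: bij_is_inj inj_on_subset[OF bij_is_inj])
    then have "\<not> A \<subseteq> g ` A" using ne fA card_subset_eq[of "g ` A" A] by auto
    then obtain a where a: "a \<in> A" "a \<notin> g ` A" by auto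
    define C where "C = A - {a}"
    have "supp C"
      unfolding supp_def
    proof (intro conjI ballI impI)
      show "finite C" using fA by (simp add: C_def)
      fix k assume k: "k \<in> Aut (law_structure w)" "\<forall>x\<in>C. k x = x"
      show "k \<in> V"
      proof (rule stabilizer_reduce[OF Vcomp Vinv VG, of "C \<union> g ` A" C a])
        show "a \<notin> C \<union> g ` A" using a by (simp add: C_def)
        fix h assume h: "h \<in> Aut (law_structure w)" "\<And>x. x \<in> insert a C \<Longrightarrow> h x = x"
        then show "h \<in> V" using A(1) by (auto simp: supp_def C_def)
      next
        fix h assume h: "h \<in> Aut (law_structure w)" "\<And>x. x \<in> C \<union> g ` A \<Longrightarrow> h x = x"
        have gi: "inv_into UNIV g (g x) = x" "g (inv_into UNIV g x) = x" for x
          using bij by (simp_all add: bij_is_inj bij_is_surj surj_f_inv_f)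
        have "inv_into UNIV g \<circ> (h \<circ> g) \<in> Aut (law_structure w)"
          using g VG h(1) Vinv by (auto intro!: Aut_comp)
        then have "inv_into UNIV g \<circ> (h \<circ> g) \<in> V"
          using A(1) h(2) gi by (auto simp: supp_def)
        then have "g \<circ> ((inv_into UNIV g \<circ> (h \<circ> g)) \<circ> inv_into UNIV g) \<in> V"
          by (rule Vcomp[OF g Vcomp[OF _ Vinv[OF g]]])
        moreover have "g \<circ> ((inv_into UNIV g \<circ> (h \<circ> g)) \<circ> inv_into UNIV g) = h"
          by (simp add: fun_eq_iff gi)
        ultimately show "h \<in> V" by simp
      qed (use k fA in \<open>auto simp: C_def\<close>)
    qed
    moreover have "card C < card A" unfolding C_def using a(1) fA by (rule card_Diff1_less[rotated])
    ultimately show False using A(2)[of C] by simp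
  qed
  obtain as where as: "set as = A" using finite_list[OF fA] by blast
  let ?H = "tuple_stabilizer (law_structure w) as"
  let ?GV = "?G\<lparr>carrier := V\<rparr>"
  have H: "?H = {g \<in> Aut (law_structure w). \<forall>a\<in>A. g a = a}" by (simp add: tuple_stabilizer_def as)
  have HV: "?H \<subseteq> V" using A(1) by (auto simp: H supp_def)
  \<comment> \<open>Inverses, because the cosets are right cosets: composing \<open>g\<close> on the
    left with an element fixing \<open>A\<close> pointwise leaves the inverse of \<open>g\<close>
    unchanged on \<open>A\<close>.\<close>
  define \<phi> where "\<phi> g = restrict (inv_into UNIV g) A" for g :: "nat \<Rightarrow> nat"
  have coset_le: "?H #>\<^bsub>?GV\<^esub> g \<subseteq> ?H #>\<^bsub>?GV\<^esub> h" if g: "g \<in> V" and h: "h \<in> V" and eq: "\<phi> g = \<phi> h" for g h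
  proof
    fix k assume "k \<in> ?H #>\<^bsub>?GV\<^esub> g"
    then obtain k' where k': "k' \<in> ?H" "k = k' \<circ> g" by (auto simp: r_coset_def aut_group_def)
    have bij: "bij g" "bij h" using g h VG by (auto simp: Aut_law_iff)
    have "(k' \<circ> (g \<circ> inv_into UNIV h)) a = a" if a: "a \<in> A" for a
    proof -
      have "inv_into UNIV h a = inv_into UNIV g a" using fun_cong[OF eq, of a] a by (simp add: \<phi>_def)
      then have "g (inv_into UNIV h a) = a" using bij(1) by (simp add: bij_is_surj surj_f_inv_f)
      then show ?thesis using k'(1) a by (simp add: H)
    qed
    moreover have "k' \<circ> (g \<circ> inv_into UNIV h) \<in> V" using Vcomp Vinv g h k'(1) HV by blast
    ultimately have "k' \<circ> (g \<circ> inv_into UNIV h) \<in> ?H" using VG by (auto simp: H)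
    moreover have "(k' \<circ> (g \<circ> inv_into UNIV h)) \<circ> h = k"
      using bij(2) by (simp add: fun_eq_iff k'(2) bij_is_inj)
    ultimately show "k \<in> ?H #>\<^bsub>?GV\<^esub> h" by (force simp: r_coset_def aut_group_def)
  qed
  have coset_eq: "?H #>\<^bsub>?GV\<^esub> g = ?H #>\<^bsub>?GV\<^esub> h" if "g \<in> V" "h \<in> V" "\<phi> g = \<phi> h" for g h
    using coset_le[OF that] coset_le[OF that(2,1) that(3)[symmetric]] by blast
  have "\<phi> ` V \<subseteq> A \<rightarrow>\<^sub>E A"
  proof
    fix f assume "f \<in> \<phi> ` V"
    then obtain g where g: "g \<in> V" "f = \<phi> g" by auto
    then have "inv_into UNIV g ` A = A" using stab Vinv by blast
    then show "f \<in> A \<rightarrow>\<^sub>E A" using g(2) by (auto simp: \<phi>_def)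
  qed
  then have "finite (\<phi> ` V)" by (rule finite_subset) (simp add: finite_PiE fA)
  moreover have "rcosets\<^bsub>?GV\<^esub> ?H = (\<lambda>y. ?H #>\<^bsub>?GV\<^esub> inv_into V \<phi> y) ` \<phi> ` V"
  proof -
    have "rcosets\<^bsub>?GV\<^esub> ?H = (\<lambda>g. ?H #>\<^bsub>?GV\<^esub> g) ` V" by (auto simp: RCOSETS_def)
    also have "\<dots> = (\<lambda>g. ?H #>\<^bsub>?GV\<^esub> inv_into V \<phi> (\<phi> g)) ` V"
    proof (rule image_cong[OF refl])
      fix g assume g: "g \<in> V"
      have "\<phi> g \<in> \<phi> ` V" using g by blast
      then have "inv_into V \<phi> (\<phi> g) \<in> V" "\<phi> (inv_into V \<phi> (\<phi> g)) = \<phi> g"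
        by (rule inv_into_into, rule f_inv_into_f)
      then show "?H #>\<^bsub>?GV\<^esub> g = ?H #>\<^bsub>?GV\<^esub> inv_into V \<phi> (\<phi> g)"
        by (intro coset_eq[OF g]) simp_all
    qed
    finally show ?thesis by (simp add: image_image)
  qed
  ultimately have "finite (rcosets\<^bsub>?GV\<^esub> ?H)" by simp
  then show "\<exists>as. set as \<subseteq> univ (law_structure w) \<and> tuple_stabilizer (law_structure w) as \<subseteq> V \<and>
      finite (rcosets\<^bsub>?GV\<^esub> tuple_stabilizer (law_structure w) as)"
    using HV by auto
qed

end

section \<open>The random field of a law\<close>

abbreviation field_space :: "(nat \<Rightarrow> real) measure" where
  "field_space \<equiv> PiM UNIV (\<lambda>_. borel)"

text \<open>Configurations are real-valued to fit the type of \<open>Z\<close> in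
  \<open>de_finetti\<close>. A configuration is read as the set of points where it equals
  \<open>1\<close>, and \<open>\<B>\<close> lists the allowed traces on \<open>J\<close>.\<close>

definition cyl :: "nat set \<Rightarrow> nat set set \<Rightarrow> (nat \<Rightarrow> real) set" where
  "cyl J \<B> = {x. {i\<in>J. x i = 1} \<in> \<B>}"

lemma space_field_space [simp]: "space field_space = UNIV"
  by (simp add: space_PiM)

lemma cyl_sets [measurable]:
  assumes "finite J"
  shows "cyl J \<B> \<in> sets field_space"
proof -
  have "{x \<in> space field_space. \<forall>i\<in>J. (x i = 1) = (i \<in> T)} \<in> sets field_space" for T
    using assms by (measurable; simp)
  then have "{x. \<forall>i\<in>J. (x i = 1) = (i \<in> T)} \<in> sets field_space" for T
    by simp
  moreover have "cyl J \<B> = (\<Union>T\<in>\<B> \<inter> Pow J. {x. \<forall>i\<in>J. (x i = 1) = (i \<in> T)})"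
  proof (intro equalityI subsetI)
    fix x assume "x \<in> cyl J \<B>"
    then show "x \<in> (\<Union>T\<in>\<B> \<inter> Pow J. {x. \<forall>i\<in>J. (x i = 1) = (i \<in> T)})"
      by (intro UN_I[of "{i\<in>J. x i = 1}"]) (auto simp: cyl_def)
  next
    fix x :: "nat \<Rightarrow> real" assume "x \<in> (\<Union>T\<in>\<B> \<inter> Pow J. {x. \<forall>i\<in>J. (x i = 1) = (i \<in> T)})"
    then obtain T where T: "T \<in> \<B>" "T \<subseteq> J" "\<forall>i\<in>J. (x i = 1) = (i \<in> T)" by auto
    then have "{i\<in>J. x i = 1} = T" by auto
    then show "x \<in> cyl J \<B>" using T(1) by (simp add: cyl_def)
  qed
  ultimately show ?thesis using assms by (auto intro!: sets.finite_UN)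
qed

lemma shift_act_inverse:
  assumes "bij g"
  shows "shift_act (inv_into UNIV g) (shift_act g x) = x" "shift_act g (shift_act (inv_into UNIV g) x) = x"
  using assms by (simp_all add: shift_act_def inv_inv_eq bij_is_inj bij_is_surj surj_f_inv_f)

lemma shift_act_image:
  assumes "bij g"
  shows "shift_act g ` A = shift_act (inv_into UNIV g) -` A"
proof (intro equalityI subsetI)
  fix x assume "x \<in> shift_act (inv_into UNIV g) -` A"
  then have "shift_act (inv_into UNIV g) x \<in> A" by simp
  then show "x \<in> shift_act g ` A" using shift_act_inverse(2)[OF assms, of x] by (metis image_eqI)
qed (auto simp: shift_act_inverse[OF assms])

lemma shift_act_measurable [measurable]: "shift_act g \<in> measurable field_space field_space"
  unfolding shift_act_def by (rule measurable_PiM_single') (auto intro: measurable_component_singleton)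

section \<open>Uniqueness and invariance of the law\<close>

context coherent
begin

text \<open>Cylinders see only whether a value equals \<open>1\<close>; the null condition excludes
  all other values except \<open>0\<close>, which makes the measure unique.\<close>

definition has_law :: "(nat \<Rightarrow> real) measure \<Rightarrow> bool" where
  "has_law \<mu> \<longleftrightarrow> prob_space \<mu> \<and> sets \<mu> = sets field_space \<and>
    (\<forall>i. measure \<mu> {x. x i \<notin> {0, 1}} = 0) \<and>
    (\<forall>J T. finite J \<longrightarrow> T \<subseteq> J \<longrightarrow> measure \<mu> (cyl J {T}) = of_rat (w J T))"

lemma has_lawD:
  assumes "has_law \<mu>"
  shows "prob_space \<mu>" "sets \<mu> = sets field_space" "space \<mu> = UNIV"
    "finite J \<Longrightarrow> T \<subseteq> J \<Longrightarrow> measure \<mu> (cyl J {T}) = of_rat (w J T)"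
    "finite J \<Longrightarrow> cyl J \<B> \<in> sets \<mu>"
  using assms sets_eq_imp_space_eq[of \<mu> field_space] cyl_sets[of J \<B>] by (auto simp: has_law_def)

lemma measure_cyl:
  assumes \<mu>: "has_law \<mu>" and J: "finite J"
  shows "measure \<mu> (cyl J \<B>) = (\<Sum>T\<in>Pow J \<inter> \<B>. of_rat (w J T))"
proof -
  interpret prob_space \<mu> using \<mu> by (rule has_lawD)
  have eq: "cyl J \<B> = (\<Union>T\<in>Pow J \<inter> \<B>. cyl J {T})" by (auto simp: cyl_def)
  have "measure \<mu> (cyl J \<B>) = (\<Sum>T\<in>Pow J \<inter> \<B>. measure \<mu> (cyl J {T}))"
    unfolding eq
  proof (rule finite_measure_finite_Union)
    show "disjoint_family_on (\<lambda>T. cyl J {T}) (Pow J \<inter> \<B>)" by (auto simp: disjoint_family_on_def cyl_def)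
  qed (use J has_lawD(5)[OF \<mu> J] in auto)
  also have "\<dots> = (\<Sum>T\<in>Pow J \<inter> \<B>. of_rat (w J T))"
    using has_lawD(4)[OF \<mu> J] by (intro sum.cong) auto
  finally show ?thesis .
qed

lemma AE_field_01:
  assumes \<mu>: "has_law \<mu>"
  shows "AE x in \<mu>. \<forall>i. x i \<in> {0, 1}"
proof -
  interpret prob_space \<mu> using \<mu> by (rule has_lawD)
  have "AE x in \<mu>. x i \<in> {0, 1}" for i
  proof (rule AE_I)
    have "{x \<in> space field_space. x i \<notin> {0, 1}} \<in> sets field_space" by measurable
    then show "{x. x i \<notin> {0, 1}} \<in> sets \<mu>" using has_lawD(2)[OF \<mu>] by simp
    show "emeasure \<mu> {x. x i \<notin> {0, 1}} = 0"
      using \<mu> by (auto simp: has_law_def emeasure_eq_measure)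
  qed auto
  then show ?thesis by (subst AE_all_countable) auto
qed

text \<open>On 0-1 configurations a product box over a finite \<open>J\<close> coincides with a
  cylinder, and boxes determine a finite measure on the product.\<close>

lemma has_law_unique:
  assumes \<mu>: "has_law \<mu>" and \<nu>: "has_law \<nu>"
  shows "\<mu> = \<nu>"
proof (rule measure_eqI_PiM_infinite[OF has_lawD(2)[OF \<mu>] has_lawD(2)[OF \<nu>]])
  show "finite_measure \<mu>" using has_lawD(1)[OF \<mu>] by (simp add: prob_space_def)
  fix A :: "nat \<Rightarrow> real set" and J :: "nat set"
  assume J: "finite J" and A: "\<And>i. i \<in> J \<Longrightarrow> A i \<in> sets borel"
  define E where "E = prod_emb UNIV (\<lambda>_. borel) J (Pi\<^sub>E J A)"
  define \<B> where "\<B> = {T. \<forall>i\<in>J. of_bool (i \<in> T) \<in> A i}"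
  have E: "E \<in> sets field_space" unfolding E_def using J A by (intro sets_PiM_I) auto
  have "measure \<xi> E = measure \<xi> (cyl J \<B>)" if \<xi>: "has_law \<xi>" for \<xi>
  proof -
    interpret prob_space \<xi> using \<xi> by (rule has_lawD)
    have "AE x in \<xi>. x \<in> E \<longleftrightarrow> x \<in> cyl J \<B>"
      using AE_field_01[OF \<xi>]
    proof eventually_elim
      fix x :: "nat \<Rightarrow> real" assume x: "\<forall>i. x i \<in> {0, 1}"
      have "of_bool (i \<in> {i\<in>J. x i = 1}) = x i" if "i \<in> J" for i using x that by (cases "x i = 1") auto
      then show "x \<in> E \<longleftrightarrow> x \<in> cyl J \<B>"
        by (auto simp: E_def prod_emb_iff cyl_def \<B>_def PiE_iff)
    qed
    then show ?thesis
      using has_lawD[OF \<xi>] E J by (intro finite_measure_eq_AE) auto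
  qed
  then have "measure \<mu> E = measure \<nu> E" using measure_cyl[OF _ J] \<mu> \<nu> by simp
  then show "emeasure \<mu> (prod_emb UNIV (\<lambda>_. borel) J (Pi\<^sub>E J A)) = emeasure \<nu> (prod_emb UNIV (\<lambda>_. borel) J (Pi\<^sub>E J A))"
    unfolding E_def[symmetric]
    using has_lawD(1)[OF \<mu>] has_lawD(1)[OF \<nu>]
    by (simp add: finite_measure.emeasure_eq_measure prob_space.finite_measure)
qed

lemma vimage_shift_cyl:
  assumes g: "bij g"
  shows "shift_act g -` cyl J \<B> = cyl (inv_into UNIV g ` J) {T. g ` T \<in> \<B>}"
proof -
  have "{i\<in>J. x (inv_into UNIV g i) = 1} = g ` {i \<in> inv_into UNIV g ` J. x i = 1}" for x :: "nat \<Rightarrow> real"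
  proof -
    have "i = g (inv_into UNIV g i)" for i using g by (simp add: bij_is_surj surj_f_inv_f)
    then show ?thesis by (force simp: image_iff)
  qed
  then show ?thesis by (auto simp: cyl_def shift_act_def)
qed

text \<open>Automorphisms preserve \<open>w\<close>, so the shifted measure has the same finite
  marginals and uniqueness applies.\<close>

lemma has_law_shift:
  assumes \<mu>: "has_law \<mu>" and g: "g \<in> Aut (law_structure w)"
  shows "distr \<mu> field_space (shift_act g) = \<mu>"
proof (rule has_law_unique[OF _ \<mu>])
  interpret prob_space \<mu> using \<mu> by (rule has_lawD)
  have bij: "bij g" using g by (simp add: Aut_law_iff)
  let ?i = "inv_into UNIV g"
  have gi: "g ` ?i ` X = X" for X using bij by (simp add: image_f_inv_f bij_is_surj)
  have [measurable]: "shift_act g \<in> measurable \<mu> field_space"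
    using shift_act_measurable measurable_cong_sets[OF has_lawD(2)[OF \<mu>] refl] by blast
  have meas: "measure (distr \<mu> field_space (shift_act g)) A = measure \<mu> (shift_act g -` A)"
    if "A \<in> sets field_space" for A
    using that has_lawD(3)[OF \<mu>] by (subst measure_distr) auto
  show "has_law (distr \<mu> field_space (shift_act g))"
    unfolding has_law_def
  proof (intro conjI allI impI)
    show "prob_space (distr \<mu> field_space (shift_act g))" by (rule prob_space_distr) simp
    fix i
    have "{x \<in> space field_space. x i \<notin> {0, 1}} \<in> sets field_space" by measurable
    moreover have "shift_act g -` {x. x i \<notin> {0, 1}} = {x. x (?i i) \<notin> {0, 1}}"
      by (auto simp: shift_act_def)
    ultimately show "measure (distr \<mu> field_space (shift_act g)) {x. x i \<notin> {0, 1}} = 0"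
      using \<mu> by (subst meas) (auto simp: has_law_def)
  next
    fix J T :: "nat set" assume J: "finite J" and T: "T \<subseteq> J"
    have "{U. g ` U \<in> {T}} = {?i ` T}"
    proof -
      have "g ` U = T \<longleftrightarrow> U = ?i ` T" for U
        using gi[of T] inj_image_eq_iff[OF bij_is_inj[OF bij], of U "?i ` T"] by auto
      then show ?thesis by auto
    qed
    then have "measure (distr \<mu> field_space (shift_act g)) (cyl J {T}) = of_rat (w (?i ` J) (?i ` T))"
      using J T by (subst meas) (auto simp: vimage_shift_cyl[OF bij] has_lawD(4)[OF \<mu>] image_mono)
    also have "w (?i ` J) (?i ` T) = w J T"
      using Aut_invariant[OF Aut_inv[OF g] J T] .
    finally show "measure (distr \<mu> field_space (shift_act g)) (cyl J {T}) = of_rat (w J T)" .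
  qed simp
qed

lemma measure_shift_image:
  assumes \<mu>: "has_law \<mu>" and g: "g \<in> Aut (law_structure w)" and A: "A \<in> sets \<mu>"
  shows "measure \<mu> (shift_act g ` A) = measure \<mu> A" "shift_act g ` A \<in> sets \<mu>"
proof -
  have bij: "bij g" using g by (simp add: Aut_law_iff)
  let ?h = "shift_act (inv_into UNIV g)"
  have h: "?h \<in> measurable \<mu> field_space"
    using shift_act_measurable measurable_cong_sets[OF has_lawD(2)[OF \<mu>] refl] by blast
  have A': "A \<in> sets field_space" using A has_lawD(2)[OF \<mu>] by simp
  have "measure (distr \<mu> field_space ?h) A = measure \<mu> (?h -` A)"
    using has_lawD(3)[OF \<mu>] by (subst measure_distr[OF h A']) simp
  then show "measure \<mu> (shift_act g ` A) = measure \<mu> A"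
    using has_law_shift[OF \<mu> Aut_inv[OF g]] shift_act_image[OF bij, of A] by simp
  show "shift_act g ` A \<in> sets \<mu>"
    using measurable_sets[OF h A'] shift_act_image[OF bij, of A] has_lawD(3)[OF \<mu>] by simp
qed

lemma has_law_invariant:
  assumes "has_law \<mu>"
  shows "invariant_prob (law_structure w) borel \<mu>"
  using has_lawD[OF assms] measure_shift_image(1)[OF assms] by (auto simp: invariant_prob_def)

section \<open>Approximation by cylinders\<close>

lemma cyl_extend:
  assumes "J \<subseteq> K"
  shows "cyl J \<B> = cyl K {T. T \<inter> J \<in> \<B>}"
proof -
  have "{i\<in>K. x i = 1} \<inter> J = {i\<in>J. x i = 1}" for x :: "nat \<Rightarrow> real" using assms by auto
  then show ?thesis by (simp add: cyl_def)
qed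

text \<open>The sets approximable by cylinders form a sigma-algebra. It contains the one-coordinate
  events, which agree with cylinders almost everywhere because the values are \<open>0\<close> or
  \<open>1\<close>.\<close>

lemma cyl_approximation:
  assumes \<mu>: "has_law \<mu>" and A: "A \<in> sets \<mu>" and "0 < \<epsilon>"
  shows "\<exists>J \<B>. finite J \<and> measure \<mu> (sym_diff A (cyl J \<B>)) < \<epsilon>"
proof -
  interpret prob_space \<mu> using \<mu> by (rule has_lawD)
  have space: "space \<mu> = UNIV" and cyl: "\<And>J \<B>. finite J \<Longrightarrow> cyl J \<B> \<in> sets \<mu>"
    using has_lawD[OF \<mu>] by auto
  have gen: "sets \<mu> = sigma_sets UNIV {{f. f i \<in> B} | i B. B \<in> sets borel}"
    using has_lawD(2)[OF \<mu>] by (simp add: sets_PiM_single PiE_UNIV_domain)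
  have "A \<in> sigma_sets UNIV {{f. f i \<in> B} | i B. B \<in> sets borel}" using A gen by simp
  then have "A \<in> sets \<mu> \<and> (\<forall>\<epsilon>>0. \<exists>J \<B>. finite J \<and> measure \<mu> (sym_diff A (cyl J \<B>)) < \<epsilon>)"
  proof induction
    case (Basic A)
    then obtain i B where A: "A = {f. f i \<in> B}" "B \<in> sets borel" by auto
    define \<B> where "\<B> = {T. of_bool (i \<in> T) \<in> B}"
    have As: "A \<in> sets \<mu>" unfolding gen using A by (intro sigma_sets.Basic) auto
    have "AE x in \<mu>. x \<notin> sym_diff A (cyl {i} \<B>)"
      using AE_field_01[OF \<mu>]
    proof eventually_elim
      fix x :: "nat \<Rightarrow> real" assume x: "\<forall>i. x i \<in> {0, 1}"
      have "of_bool (i \<in> {j\<in>{i}. x j = 1}) = x i" using x by (cases "x i = 1") auto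
      then show "x \<notin> sym_diff A (cyl {i} \<B>)" by (auto simp: A cyl_def \<B>_def)
    qed
    then have "measure \<mu> (sym_diff A (cyl {i} \<B>)) = 0"
      using As cyl[of "{i}" \<B>] by (subst prob_eq_0) auto
    then show ?case using As by (metis finite.emptyI finite.insertI)
  next
    case Empty
    have "cyl {} {} = {}" by (simp add: cyl_def)
    then show ?case by (auto intro!: exI[of _ "{}"])
  next
    case (Compl A)
    have "sym_diff (UNIV - A) (cyl J (- \<B>)) = sym_diff A (cyl J \<B>)" for J \<B>
      by (auto simp: cyl_def)
    moreover have "UNIV - A \<in> sets \<mu>" using Compl.IH sets.compl_sets[of A \<mu>] space by simp
    ultimately show ?case using Compl.IH by metis
  next
    case (Union A)
    have As: "A n \<in> sets \<mu>" for n using Union.IH by blast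
    have "\<exists>J \<B>. finite J \<and> measure \<mu> (sym_diff (\<Union>n. A n) (cyl J \<B>)) < \<epsilon>" if \<epsilon>: "0 < \<epsilon>" for \<epsilon>
    proof -
      have "(\<lambda>N. measure \<mu> (\<Union>n\<le>N. A n)) \<longlonglongrightarrow> measure \<mu> (\<Union>N. \<Union>n\<le>N. A n)"
        by (rule finite_Lim_measure_incseq) (use As in \<open>auto simp: incseq_def intro: order_trans\<close>)
      moreover have "(\<Union>N. \<Union>n\<le>N. A n) = (\<Union>n. A n)" by auto
      ultimately have "(\<lambda>N. measure \<mu> (\<Union>n\<le>N. A n)) \<longlonglongrightarrow> measure \<mu> (\<Union>n. A n)" by simp
      then have "\<forall>\<^sub>F N in sequentially. measure \<mu> (\<Union>n. A n) - \<epsilon>/2 < measure \<mu> (\<Union>n\<le>N. A n)"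
        using \<epsilon> by (intro order_tendstoD) auto
      then obtain N where N: "measure \<mu> (\<Union>n. A n) - \<epsilon>/2 < measure \<mu> (\<Union>n\<le>N. A n)"
        by (auto simp: eventually_sequentially)
      \<comment> \<open>Half of \<open>\<epsilon>\<close> pays for cutting the union at
        \<open>N\<close>; the other half is shared by the \<open>N + 1\<close> sets that
        remain.\<close>
      have pos: "0 < \<epsilon> / (2 * (real N + 1))" using \<epsilon> by simp
      have "\<forall>n. \<exists>J \<B>. finite J \<and> measure \<mu> (sym_diff (A n) (cyl J \<B>)) < \<epsilon> / (2 * (real N + 1))"
        using Union.IH pos by blast
      then obtain J \<B> where JB: "\<And>n. finite (J n)"
          "\<And>n. measure \<mu> (sym_diff (A n) (cyl (J n) (\<B> n))) < \<epsilon> / (2 * (real N + 1))"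
        by metis
      define K where "K = (\<Union>n\<le>N. J n)"
      define \<C> where "\<C> = {T. \<exists>n\<le>N. T \<inter> J n \<in> \<B> n}"
      have K: "finite K" using JB(1) by (simp add: K_def)
      have C: "cyl K \<C> = (\<Union>n\<le>N. cyl (J n) (\<B> n))"
      proof -
        have "cyl (J n) (\<B> n) = cyl K {T. T \<inter> J n \<in> \<B> n}" if "n \<le> N" for n
          using that by (intro cyl_extend) (auto simp: K_def)
        then show ?thesis by (auto simp: \<C>_def cyl_def)
      qed
      have sets: "sym_diff (A n) (cyl (J n) (\<B> n)) \<in> sets \<mu>" for n using As cyl JB(1) by auto
      have "sym_diff (\<Union>n. A n) (cyl K \<C>)
        \<subseteq> ((\<Union>n. A n) - (\<Union>n\<le>N. A n)) \<union> (\<Union>n\<le>N. sym_diff (A n) (cyl (J n) (\<B> n)))"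
        unfolding C by blast
      then have "measure \<mu> (sym_diff (\<Union>n. A n) (cyl K \<C>))
        \<le> measure \<mu> (((\<Union>n. A n) - (\<Union>n\<le>N. A n)) \<union> (\<Union>n\<le>N. sym_diff (A n) (cyl (J n) (\<B> n))))"
        using As sets by (intro finite_measure_mono) auto
      also have "\<dots> \<le> measure \<mu> ((\<Union>n. A n) - (\<Union>n\<le>N. A n))
          + measure \<mu> (\<Union>n\<le>N. sym_diff (A n) (cyl (J n) (\<B> n)))"
        using As sets by (intro measure_Un_le) auto
      also have "measure \<mu> ((\<Union>n. A n) - (\<Union>n\<le>N. A n)) = measure \<mu> (\<Union>n. A n) - measure \<mu> (\<Union>n\<le>N. A n)"
        using As by (intro finite_measure_Diff) auto
      also have "measure \<mu> (\<Union>n\<le>N. sym_diff (A n) (cyl (J n) (\<B> n)))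
          \<le> (\<Sum>n\<le>N. measure \<mu> (sym_diff (A n) (cyl (J n) (\<B> n))))"
        using sets by (intro measure_UNION_le) auto
      also have "\<dots> \<le> (\<Sum>n\<le>N. \<epsilon> / (2 * (real N + 1)))"
        using JB(2) by (intro sum_mono) (auto intro: less_imp_le)
      also have "\<dots> = \<epsilon> / 2" by (simp add: field_simps)
      finally have "measure \<mu> (sym_diff (\<Union>n. A n) (cyl K \<C>)) < \<epsilon>" using N by simp
      then show ?thesis using K by blast
    qed
    moreover have "(\<Union>n. A n) \<in> sets \<mu>" using As by blast
    ultimately show ?case by blast
  qed
  then show ?thesis using \<open>0 < \<epsilon>\<close> by blast
qed

text \<open>Nested intervals: a uniform point of \<open>[0, 1)\<close> generates the random set, the pattern \<open>T\<close> on
  \<open>{..<n}\<close> corresponding to an interval of length \<open>w {..<n} T\<close> starting at \<open>lo n T\<close>.\<close>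

primrec lo :: "nat \<Rightarrow> nat set \<Rightarrow> real" where
  "lo 0 T = 0"
| "lo (Suc n) T = (if n \<in> T then lo n (T - {n}) else lo n T + of_rat (w {..<Suc n} (insert n T)))"

primrec pattern :: "nat \<Rightarrow> real \<Rightarrow> nat set" where
  "pattern 0 \<omega> = {}"
| "pattern (Suc n) \<omega> =
    (if \<omega> < lo n (pattern n \<omega>) + of_rat (w {..<Suc n} (insert n (pattern n \<omega>)))
     then insert n (pattern n \<omega>) else pattern n \<omega>)"

lemma pattern_subset: "pattern n \<omega> \<subseteq> {..<n}"
  by (induction n) (auto simp: lessThan_Suc)

lemma pattern_Int: "m \<le> n \<Longrightarrow> pattern n \<omega> \<inter> {..<m} = pattern m \<omega>"
proof (induction n rule: dec_induct)
  case base
  then show ?case using pattern_subset by blast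
next
  case (step n)
  then show ?case by auto
qed

text \<open>The interval of a pattern on \<open>{..<n}\<close> is cut in two, the left part going to
  the pattern that contains \<open>n\<close>; half-open intervals make the cut exact.\<close>

lemma pattern_eq_iff:
  assumes "0 \<le> \<omega>" "\<omega> < 1" "T \<subseteq> {..<n}"
  shows "pattern n \<omega> = T \<longleftrightarrow> lo n T \<le> \<omega> \<and> \<omega> < lo n T + of_rat (w {..<n} T)"
  using assms(3)
proof (induction n arbitrary: T)
  case 0
  then show ?case using assms total by simp
next
  case (Suc n)
  define U where "U = T - {n}"
  have U: "U \<subseteq> {..<n}" "n \<notin> U" using Suc.prems by (auto simp: U_def lessThan_Suc)
  have n: "n \<notin> pattern n \<omega>" using pattern_subset[of n \<omega>] by auto
  have "w {..<n} U = w (insert n {..<n}) U + w (insert n {..<n}) (insert n U)"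
    using U by (intro split) auto
  then have s: "real_of_rat (w {..<n} U)
      = of_rat (w {..<Suc n} U) + of_rat (w {..<Suc n} (insert n U))"
    by (simp add: lessThan_Suc of_rat_add)
  have "0 < w {..<Suc n} U" "0 < w {..<Suc n} (insert n U)"
    using U by (auto intro!: pos)
  then have p: "0 < real_of_rat (w {..<Suc n} U)" "0 < real_of_rat (w {..<Suc n} (insert n U))"
    by simp_all
  show ?case
  proof (cases "n \<in> T")
    case True
    then have T: "T = insert n U" by (auto simp: U_def)
    have "pattern (Suc n) \<omega> = T \<longleftrightarrow>
      pattern n \<omega> = U \<and> \<omega> < lo n U + of_rat (w {..<Suc n} (insert n U))"
      using n U(2) unfolding T by (auto simp: insert_eq_iff)
    moreover have "lo (Suc n) T = lo n U" using True by (simp add: U_def)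
    ultimately show ?thesis
      using Suc.IH[OF U(1)] s p(1) unfolding T by (simp only:) linarith
  next
    case False
    then have T: "T = U" by (auto simp: U_def)
    have "pattern (Suc n) \<omega> = T \<longleftrightarrow>
      pattern n \<omega> = U \<and> \<not> \<omega> < lo n U + of_rat (w {..<Suc n} (insert n U))"
      using n U(2) unfolding T by auto
    moreover have "lo (Suc n) T = lo n U + of_rat (w {..<Suc n} (insert n U))"
      using False by (simp add: T)
    ultimately show ?thesis
      using Suc.IH[OF U(1)] s p(2) unfolding T by (simp only:) linarith
  qed
qed

text \<open>\<open>pattern_eq_iff\<close> speaks only of points of \<open>[0, 1)\<close>. These
  bounds place each interval inside it, so that its whole length counts.\<close>

lemma lo_bounds:
  assumes "T \<subseteq> {..<n}"
  shows "0 \<le> lo n T" "lo n T + of_rat (w {..<n} T) \<le> 1"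
proof -
  have "0 \<le> lo n T \<and> lo n T + of_rat (w {..<n} T) \<le> 1"
    using assms
  proof (induction n arbitrary: T)
    case 0
    then show ?case using total by simp
  next
    case (Suc n)
    define U where "U = T - {n}"
    have U: "U \<subseteq> {..<n}" "n \<notin> U" using Suc.prems by (auto simp: U_def lessThan_Suc)
    have "w {..<n} U = w (insert n {..<n}) U + w (insert n {..<n}) (insert n U)"
      using U by (intro split) auto
    then have s: "real_of_rat (w {..<n} U)
        = of_rat (w {..<Suc n} U) + of_rat (w {..<Suc n} (insert n U))"
      by (simp add: lessThan_Suc of_rat_add)
    have "0 < w {..<Suc n} U" "0 < w {..<Suc n} (insert n U)"
      using U by (auto intro!: pos)
    then have p: "0 < real_of_rat (w {..<Suc n} U)" "0 < real_of_rat (w {..<Suc n} (insert n U))"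
      by simp_all
    have "T = insert n U \<or> T = U" by (auto simp: U_def)
    then show ?case
    proof
      assume T: "T = insert n U"
      then have "lo (Suc n) T = lo n U" using U(2) by simp
      then show ?thesis using Suc.IH[OF U(1)] s p(1) unfolding T by linarith
    next
      assume T: "T = U"
      then have "lo (Suc n) T = lo n U + of_rat (w {..<Suc n} (insert n U))" using U(2) by simp
      then show ?thesis using Suc.IH[OF U(1)] s p(2) unfolding T by linarith
    qed
  qed
  then show "0 \<le> lo n T" "lo n T + of_rat (w {..<n} T) \<le> 1" by auto
qed

lemma has_law_exists: "\<exists>\<mu>. has_law \<mu>"
proof -
  note pattern.simps(2) [simp del]
  define \<Omega> where "\<Omega> = restrict_space lborel {0..<1::real}"
  have space: "space \<Omega> = {0..<1}" by (simp add: \<Omega>_def space_restrict_space)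
  have sets: "A \<in> sets \<Omega>" if "A \<in> sets borel" "A \<subseteq> {0..<1}" for A
    using that by (auto simp: \<Omega>_def sets_restrict_space)
  have meas: "measure \<Omega> A = measure lborel A" if "A \<subseteq> {0..<1}" for A
    using that unfolding \<Omega>_def by (subst measure_restrict_space) auto
  have "emeasure \<Omega> {0..<1} = emeasure lborel {0..<1::real}"
    unfolding \<Omega>_def by (rule emeasure_restrict_space) auto
  then interpret prob_space \<Omega>
    by (intro prob_spaceI) (simp add: space)
  \<comment> \<open>\<open>pattern (Suc i)\<close> is the first pattern that decides
    \<open>i\<close>, and all later ones agree with it by \<open>pattern_Int\<close>.\<close>
  define field where "field \<omega> i = (of_bool (i \<in> pattern (Suc i) \<omega>) :: real)" for \<omega> i
  have field: "{i\<in>{..<n}. field \<omega> i = 1} = pattern n \<omega>" for n \<omega>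
  proof -
    have "i \<in> pattern (Suc i) \<omega> \<longleftrightarrow> i \<in> pattern n \<omega>" if "i < n" for i
      using pattern_Int[of "Suc i" n \<omega>] that by (metis IntD1 IntI Suc_leI lessI lessThan_iff)
    then show ?thesis using pattern_subset[of n \<omega>] by (auto simp: field_def)
  qed
  have interval: "{\<omega>\<in>{0..<1}. pattern n \<omega> = T} = {lo n T..<lo n T + of_rat (w {..<n} T)}"
    if T: "T \<subseteq> {..<n}" for n T
  proof (intro equalityI subsetI)
    fix \<omega> assume "\<omega> \<in> {\<omega>\<in>{0..<1}. pattern n \<omega> = T}"
    then show "\<omega> \<in> {lo n T..<lo n T + of_rat (w {..<n} T)}"
      using pattern_eq_iff[of \<omega>, OF _ _ T] by simp
  next
    fix \<omega> assume \<omega>: "\<omega> \<in> {lo n T..<lo n T + of_rat (w {..<n} T)}"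
    then have "0 \<le> \<omega>" "\<omega> < 1" using lo_bounds[OF T] by simp_all
    then show "\<omega> \<in> {\<omega>\<in>{0..<1}. pattern n \<omega> = T}"
      using pattern_eq_iff[OF _ _ T] \<omega> by simp
  qed
  have pat_sets: "{\<omega>\<in>{0..<1}. pattern n \<omega> \<in> \<B>} \<in> sets \<Omega>" for n \<B>
  proof -
    have "{\<omega>\<in>{0..<1}. pattern n \<omega> \<in> \<B>} = (\<Union>T\<in>\<B> \<inter> Pow {..<n}. {\<omega>\<in>{0..<1}. pattern n \<omega> = T})"
      using pattern_subset by auto
    moreover have "{\<omega>\<in>{0..<1}. pattern n \<omega> = T} \<in> sets \<Omega>" if "T \<in> \<B> \<inter> Pow {..<n}" for T
    proof (rule sets)
      have "{\<omega>\<in>{0..<1}. pattern n \<omega> = T} = {lo n T..<lo n T + of_rat (w {..<n} T)}"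
        using that by (intro interval) auto
      then show "{\<omega>\<in>{0..<1}. pattern n \<omega> = T} \<in> sets borel" by simp
    qed auto
    ultimately show ?thesis by (auto intro!: sets.finite_UN)
  qed
  have field_meas: "field \<in> measurable \<Omega> field_space"
    unfolding field_def
  proof (rule measurable_PiM_single')
    fix i
    have "{\<omega> \<in> space \<Omega>. i \<in> pattern (Suc i) \<omega>} \<in> sets \<Omega>"
      using pat_sets[of "Suc i" "{T. i \<in> T}"] space by simp
    then show "(\<lambda>\<omega>. of_bool (i \<in> pattern (Suc i) \<omega>)) \<in> borel_measurable \<Omega>"
      by measurable
  qed auto
  define \<mu> where "\<mu> = distr \<Omega> field_space field"
  have mu: "measure \<mu> A = measure \<Omega> {\<omega>\<in>{0..<1}. field \<omega> \<in> A}" if "A \<in> sets field_space" for A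
    unfolding \<mu>_def using that field_meas
    by (subst measure_distr) (auto simp: space vimage_def intro!: arg_cong[where f = "measure \<Omega>"])
  have "has_law \<mu>"
    unfolding has_law_def
  proof (intro conjI allI impI)
    show "prob_space \<mu>" unfolding \<mu>_def by (rule prob_space_distr[OF field_meas])
    show "sets \<mu> = sets field_space" by (simp add: \<mu>_def)
    fix i
    have "{x \<in> space field_space. x i \<notin> {0, 1}} \<in> sets field_space" by measurable
    then show "measure \<mu> {x. x i \<notin> {0, 1}} = 0"
      by (subst mu) (auto simp: field_def)
  next
    fix J T :: "nat set" assume J: "finite J" and T: "T \<subseteq> J"
    obtain n where "\<forall>i\<in>J. i < n" using J finite_nat_set_iff_bounded by auto
    then have Jn: "J \<subseteq> {..<n}" by auto
    define \<C> where "\<C> = {Z\<in>Pow {..<n}. Z \<inter> J = T}"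
    have "{\<omega>\<in>{0..<1}. field \<omega> \<in> cyl J {T}} = (\<Union>Z\<in>\<C>. {\<omega>\<in>{0..<1}. pattern n \<omega> = Z})"
      unfolding cyl_extend[OF Jn] using pattern_subset[of n]
      by (auto simp: cyl_def field[unfolded lessThan_iff] \<C>_def)
    then have "measure \<mu> (cyl J {T}) = measure \<Omega> (\<Union>Z\<in>\<C>. {\<omega>\<in>{0..<1}. pattern n \<omega> = Z})"
      using cyl_sets[OF J] by (simp add: mu)
    also have "\<dots> = (\<Sum>Z\<in>\<C>. measure \<Omega> {\<omega>\<in>{0..<1}. pattern n \<omega> = Z})"
    proof (rule finite_measure_finite_Union)
      show "(\<lambda>Z. {\<omega>\<in>{0..<1}. pattern n \<omega> = Z}) ` \<C> \<subseteq> sets \<Omega>"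
        using pat_sets[of n "{_}"] by auto
      show "disjoint_family_on (\<lambda>Z. {\<omega>\<in>{0..<1}. pattern n \<omega> = Z}) \<C>"
        by (auto simp: disjoint_family_on_def)
    qed (simp add: \<C>_def)
    also have "\<dots> = (\<Sum>Z\<in>\<C>. of_rat (w {..<n} Z))"
    proof (rule sum.cong[OF refl])
      fix Z assume "Z \<in> \<C>"
      then have Z: "Z \<subseteq> {..<n}" by (simp add: \<C>_def)
      have "0 \<le> real_of_rat (w {..<n} Z)" using pos[OF _ Z] by (simp add: less_imp_le)
      have "measure \<Omega> {\<omega>\<in>{0..<1}. pattern n \<omega> = Z} = measure lborel {\<omega>\<in>{0..<1}. pattern n \<omega> = Z}"
        by (rule meas) auto
      also have "\<dots> = of_rat (w {..<n} Z)"
        using \<open>0 \<le> real_of_rat (w {..<n} Z)\<close> unfolding interval[OF Z] by simp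
      finally show "measure \<Omega> {\<omega>\<in>{0..<1}. pattern n \<omega> = Z} = of_rat (w {..<n} Z)" .
    qed
    also have "\<dots> = of_rat (w J T)"
      using marginal[OF _ Jn T] by (simp add: \<C>_def of_rat_sum)
    finally show "measure \<mu> (cyl J {T}) = of_rat (w J T)" .
  qed
  then show ?thesis ..
qed

end

section \<open>Failure of the de Finetti property\<close>

context generic
begin

text \<open>The copy is built one point at a time. Each new point relates to the copied points as
  \<open>j\<close> relates to \<open>J\<close>, while the trace on \<open>K\<close> stays
  independent of the whole copy.\<close>

lemma independent_copy:
  assumes K: "finite K" and "finite J"
  obtains g where "g \<in> Aut (law_structure w)" "g ` J \<inter> K = {}"
    "\<And>Y T. Y \<subseteq> K \<Longrightarrow> T \<subseteq> J \<Longrightarrow> w (K \<union> g ` J) (Y \<union> g ` T) = w K Y * w J T"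
proof -
  define Q where "Q J f \<longleftrightarrow> preserves f J \<and> f ` J \<inter> K = {} \<and>
    (\<forall>Y\<subseteq>K. \<forall>T\<subseteq>J. w (K \<union> f ` J) (Y \<union> f ` T) = w K Y * w J T)" for J f
  have "\<exists>f. Q J f"
    using assms(2)
  proof (induction J rule: finite_induct)
    case empty
    show ?case by (intro exI[of _ "\<lambda>x. x"]) (auto simp: Q_def total)
  next
    case (insert j J)
    then obtain f where "Q J f" by blast
    then have f: "preserves f J" "f ` J \<inter> K = {}"
      "\<And>Y T. Y \<subseteq> K \<Longrightarrow> T \<subseteq> J \<Longrightarrow> w (K \<union> f ` J) (Y \<union> f ` T) = w K Y * w J T"
      by (simp_all add: Q_def)
    have inj: "inj_on f J" using f(1) by (simp add: preserves_def)
    define S where "S = K \<union> f ` J"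
    have S: "finite S" using K insert by (simp add: S_def)
    define v where "v Z = w K (Z \<inter> K) * w (insert j J) (insert j (J \<inter> f -` Z))" for Z
    have v: "v (Y \<union> f ` T) = w K Y * w (insert j J) (insert j T)" if "Y \<subseteq> K" "T \<subseteq> J" for Y T
    proof -
      have "(Y \<union> f ` T) \<inter> K = Y" using that f(2) by blast
      moreover have "J \<inter> f -` (Y \<union> f ` T) = T"
      proof (intro equalityI subsetI)
        fix x assume x: "x \<in> J \<inter> f -` (Y \<union> f ` T)"
        then have "f x \<notin> Y" using that(1) f(2) by blast
        then have "f x \<in> f ` T" using x by blast
        then show "x \<in> T" using inj_on_image_mem_iff[OF inj _ that(2)] x by blast
      qed (use that in blast)
      ultimately show ?thesis by (simp add: v_def)
    qed
    have decomp: "\<exists>Y T. Y \<subseteq> K \<and> T \<subseteq> J \<and> Z = Y \<union> f ` T" if "Z \<subseteq> S" for Z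
    proof (intro exI conjI)
      show "Z = (Z \<inter> K) \<union> f ` (J \<inter> f -` Z)" using that by (auto simp: S_def)
    qed auto
    have bij: "bij_betw (\<lambda>(Y, T). Y \<union> f ` T) (Pow K \<times> Pow J) (Pow S)"
      unfolding bij_betw_def
    proof (intro conjI inj_onI)
      fix p q assume p: "p \<in> Pow K \<times> Pow J" and q: "q \<in> Pow K \<times> Pow J"
        and eq: "(case p of (Y, T) \<Rightarrow> Y \<union> f ` T) = (case q of (Y, T) \<Rightarrow> Y \<union> f ` T)"
      obtain Y T Y' T' where pq: "p = (Y, T)" "q = (Y', T')" by fastforce
      have s: "Y \<subseteq> K" "T \<subseteq> J" "Y' \<subseteq> K" "T' \<subseteq> J" and e: "Y \<union> f ` T = Y' \<union> f ` T'"
        using p q eq pq by auto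
      have "Y = (Y \<union> f ` T) \<inter> K" "Y' = (Y' \<union> f ` T') \<inter> K"
        "f ` T = (Y \<union> f ` T) \<inter> f ` J" "f ` T' = (Y' \<union> f ` T') \<inter> f ` J"
        using s f(2) by blast+
      then have "Y = Y'" "f ` T = f ` T'" using e by simp_all
      then show "p = q" using inj_on_image_eq_iff[OF inj s(2,4)] pq by simp
    next
      show "(\<lambda>(Y, T). Y \<union> f ` T) ` (Pow K \<times> Pow J) = Pow S"
      proof (intro equalityI subsetI)
        fix Z assume "Z \<in> Pow S"
        then have "\<exists>Y T. Y \<subseteq> K \<and> T \<subseteq> J \<and> Z = Y \<union> f ` T" by (intro decomp) simp
        then obtain Y T where "Y \<subseteq> K" "T \<subseteq> J" "Z = Y \<union> f ` T" by (elim exE conjE)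
        then show "Z \<in> (\<lambda>(Y, T). Y \<union> f ` T) ` (Pow K \<times> Pow J)"
          by (intro image_eqI[of _ _ "(Y, T)"]) simp_all
      next
        fix Z assume "Z \<in> (\<lambda>(Y, T). Y \<union> f ` T) ` (Pow K \<times> Pow J)"
        then obtain p where p: "p \<in> Pow K \<times> Pow J" "Z = (case p of (Y, T) \<Rightarrow> Y \<union> f ` T)" by (elim imageE)
        obtain Y T where "p = (Y, T)" by (cases p)
        then have "Y \<subseteq> K" "T \<subseteq> J" "Z = Y \<union> f ` T" using p by simp_all
        then show "Z \<in> Pow S" using image_mono[of T J f] by (auto simp: S_def)
      qed
    qed
    have "\<exists>b. b \<notin> S \<and> (\<forall>Z\<subseteq>S. w (insert b S) (insert b Z) = v Z)"
    proof (rule ext[OF S])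
      fix Z assume "Z \<subseteq> S"
      then have "\<exists>Y T. Y \<subseteq> K \<and> T \<subseteq> J \<and> Z = Y \<union> f ` T" by (rule decomp)
      then obtain Y T where Z: "Y \<subseteq> K" "T \<subseteq> J" "Z = Y \<union> f ` T" by (elim exE conjE)
      have "0 < w K Y" using pos[OF K Z(1)] .
      then show "0 < v Z \<and> v Z < w S Z"
        using new_point_bounds[OF insert.hyps(1,2) Z(2)] v[OF Z(1,2)] f(3)[OF Z(1,2)] Z(3)
        by (simp add: S_def)
    next
      have "(\<Sum>Z\<in>Pow S. v Z) = (\<Sum>(Y, T)\<in>Pow K \<times> Pow J. v (Y \<union> f ` T))"
        using sum.reindex_bij_betw[OF bij, of v] by (simp add: case_prod_beta)
      also have "\<dots> = (\<Sum>(Y, T)\<in>Pow K \<times> Pow J. w K Y * w (insert j J) (insert j T))"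
        by (intro sum.cong) (auto simp: v)
      also have "\<dots> = (\<Sum>Y\<in>Pow K. w K Y) * (\<Sum>T\<in>Pow J. w (insert j J) (insert j T))"
        by (simp add: sum_product sum.cartesian_product)
      also have "(\<Sum>Y\<in>Pow K. w K Y) = 1"
        using sum_marginal[OF K, of "{}" "\<lambda>_. 1"] total by simp
      finally show "(\<Sum>Z\<in>Pow S. v Z) = 1/2" using sum_new_point[OF insert.hyps(1,2)] by simp
    qed
    then obtain b where b: "b \<notin> S" "\<And>Z. Z \<subseteq> S \<Longrightarrow> w (insert b S) (insert b Z) = v Z" by blast
    define g where "g = f(j := b)"
    have g_im: "g ` T = f ` T" if "T \<subseteq> J" for T
      using that insert.hyps(2) by (intro image_cong) (auto simp: g_def)
    have g_im': "g ` insert j T = insert b (f ` T)" if "T \<subseteq> J" for T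
    proof -
      have "g j = b" by (simp add: g_def)
      then show ?thesis using g_im[OF that] by simp
    qed
    have law: "w (insert b S) (Y \<union> g ` T) = w K Y * w (insert j J) T"
      if Y: "Y \<subseteq> K" and T: "T \<subseteq> insert j J" for Y T
    proof -
      define U where "U = T - {j}"
      have U: "U \<subseteq> J" using T by (auto simp: U_def)
      have sub: "Y \<union> f ` U \<subseteq> S" using Y U by (auto simp: S_def)
      have in_case: "w (insert b S) (Y \<union> g ` insert j U) = w K Y * w (insert j J) (insert j U)"
        using b(2)[OF sub] v[OF Y U] g_im'[OF U] by simp
      show ?thesis
      proof (cases "j \<in> T")
        case True
        then have "T = insert j U" by (auto simp: U_def)
        then show ?thesis using in_case by simp
      next
        case False
        then have T': "T = U" by (auto simp: U_def)
        have "w S (Y \<union> f ` U) = w (insert b S) (Y \<union> f ` U) + w (insert b S) (insert b (Y \<union> f ` U))"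
          by (rule split[OF S b(1) sub])
        moreover have "w J U = w (insert j J) U + w (insert j J) (insert j U)"
          by (rule split[OF insert.hyps(1,2) U])
        moreover have "w S (Y \<union> f ` U) = w K Y * w J U" using f(3)[OF Y U] by (simp add: S_def)
        moreover have "w (insert b S) (insert b (Y \<union> f ` U)) = w K Y * w (insert j J) (insert j U)"
          using b(2)[OF sub] v[OF Y U] by simp
        ultimately show ?thesis
          using g_im[OF U] T' by (simp add: distrib_left)
      qed
    qed
    have im: "g ` insert j J = insert b (f ` J)" by (rule g_im'[OF subset_refl])
    have gS: "K \<union> g ` insert j J = insert b S" unfolding im S_def by auto
    have disj: "g ` insert j J \<inter> K = {}" using im b(1) f(2) by (auto simp: S_def)
    \<comment> \<open>Summing the product law over all traces on \<open>K\<close> leaves the law of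
      the copy alone.\<close>
    have "preserves g (insert j J)"
      unfolding preserves_def
    proof (intro conjI allI impI)
      have "g x = f x" if "x \<in> J" for x using that insert.hyps(2) by (auto simp: g_def)
      then have "inj_on g J" using inj inj_on_cong[of J g f] by simp
      moreover have "g j \<notin> g ` J"
      proof -
        have "g j = b" by (simp add: g_def)
        then show ?thesis using g_im[OF subset_refl] b(1) by (simp add: S_def)
      qed
      ultimately show "inj_on g (insert j J)" using insert.hyps(2) by (simp add: inj_on_insert)
      fix T assume T: "T \<subseteq> insert j J"
      have "w (g ` insert j J) (g ` T)
        = (\<Sum>Z\<in>{Z\<in>Pow (insert b S). Z \<inter> g ` insert j J = g ` T}. w (insert b S) Z)"
        by (rule marginal) (use S T gS in auto)
      also have "\<dots> = (\<Sum>Y\<in>Pow K. w (insert b S) (Y \<union> g ` T))"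
      proof (rule sum.reindex_bij_witness[of _ "\<lambda>Y. Y \<union> g ` T" "\<lambda>Z. Z \<inter> K"])
        fix Z assume "Z \<in> {Z\<in>Pow (insert b S). Z \<inter> g ` insert j J = g ` T}"
        then have Z: "Z \<subseteq> K \<union> g ` insert j J" "Z \<inter> g ` insert j J = g ` T" using gS by auto
        then show "Z \<inter> K \<union> g ` T = Z" by blast
        then show "w (insert b S) (Z \<inter> K \<union> g ` T) = w (insert b S) Z" by simp
      next
        fix Y assume Y: "Y \<in> Pow K"
        have gT: "g ` T \<subseteq> g ` insert j J" using T by (rule image_mono)
        show "(Y \<union> g ` T) \<inter> K = Y" using Y gT disj by blast
        have "Y \<union> g ` T \<subseteq> insert b S" using Y gT gS by blast
        moreover have "(Y \<union> g ` T) \<inter> g ` insert j J = g ` T" using Y gT disj by blast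
        ultimately show "Y \<union> g ` T \<in> {Z\<in>Pow (insert b S). Z \<inter> g ` insert j J = g ` T}" by simp
      qed auto
      also have "\<dots> = (\<Sum>Y\<in>Pow K. w K Y) * w (insert j J) T"
        using law T by (simp add: sum_distrib_right)
      also have "(\<Sum>Y\<in>Pow K. w K Y) = 1"
        using sum_marginal[OF K, of "{}" "\<lambda>_. 1"] total by simp
      finally show "w (g ` insert j J) (g ` T) = w (insert j J) T" by simp
    qed
    then have "Q (insert j J) g" using disj law gS by (simp add: Q_def)
    then show ?case by blast
  qed
  then obtain f where "Q J f" ..
  then have f: "preserves f J" "f ` J \<inter> K = {}"
    "\<And>Y T. Y \<subseteq> K \<Longrightarrow> T \<subseteq> J \<Longrightarrow> w (K \<union> f ` J) (Y \<union> f ` T) = w K Y * w J T"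
    by (simp_all add: Q_def)
  obtain g where g: "g \<in> Aut (law_structure w)" "\<forall>x\<in>J. g x = f x"
    using preserves_extends_to_Aut[OF f(1) assms(2)] by blast
  have "g ` T = f ` T" if "T \<subseteq> J" for T using g(2) that by (intro image_cong) auto
  then show ?thesis using that[OF g(1)] f(2,3) by simp
qed

text \<open>Moving \<open>J\<close> to an independent copy of itself makes the cylinder and its
  shift independent events of equal probability.\<close>

lemma cyl_mixing:
  assumes \<mu>: "has_law \<mu>" and J: "finite J"
  obtains g where "g \<in> Aut (law_structure w)"
    "measure \<mu> (cyl J \<B> \<inter> shift_act g ` cyl J \<B>) = (measure \<mu> (cyl J \<B>))\<^sup>2"
proof -
  obtain g where g: "g \<in> Aut (law_structure w)" "g ` J \<inter> J = {}"
    "\<And>Y T. Y \<subseteq> J \<Longrightarrow> T \<subseteq> J \<Longrightarrow> w (J \<union> g ` J) (Y \<union> g ` T) = w J Y * w J T"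
    using independent_copy[OF J J] by metis
  have bij: "bij g" using g(1) by (simp add: Aut_law_iff)
  have inj: "inj g" using bij by (rule bij_is_inj)
  let ?i = "inv_into UNIV g"
  have ig: "?i ` g ` X = X" for X using inj by (simp add: image_image)
  have gi: "g ` ?i ` X = X" for X using bij by (simp add: image_f_inv_f bij_is_surj)
  define K where "K = J \<union> g ` J"
  define \<C> where "\<C> = {Z. Z \<inter> J \<in> \<B> \<and> ?i ` (Z \<inter> g ` J) \<in> \<B>}"
  have "shift_act g ` cyl J \<B> = cyl (g ` J) {T. ?i ` T \<in> \<B>}"
    using shift_act_image[OF bij, of "cyl J \<B>"] vimage_shift_cyl[OF bij_imp_bij_inv[OF bij], of J \<B>]
    by (simp add: inv_inv_eq[OF bij])
  also have "\<dots> = cyl K {Z. ?i ` (Z \<inter> g ` J) \<in> \<B>}"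
    by (subst cyl_extend[of "g ` J" K]) (auto simp: K_def)
  finally have "cyl J \<B> \<inter> shift_act g ` cyl J \<B> = cyl K \<C>"
    unfolding \<C>_def by (subst cyl_extend[of J K]) (auto simp: K_def cyl_def)
  then have "measure \<mu> (cyl J \<B> \<inter> shift_act g ` cyl J \<B>) = (\<Sum>Z\<in>Pow K \<inter> \<C>. of_rat (w K Z))"
    using measure_cyl[OF \<mu>, of K \<C>] J by (simp add: K_def)
  also have "\<dots> = (\<Sum>(Y, T)\<in>(Pow J \<inter> \<B>) \<times> (Pow J \<inter> \<B>). of_rat (w K (Y \<union> g ` T)))"
  proof (rule sum.reindex_bij_witness[of _ "\<lambda>(Y, T). Y \<union> g ` T" "\<lambda>Z. (Z \<inter> J, ?i ` (Z \<inter> g ` J))"])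
    fix Z assume Z: "Z \<in> Pow K \<inter> \<C>"
    then show eq: "(case (Z \<inter> J, ?i ` (Z \<inter> g ` J)) of (Y, T) \<Rightarrow> Y \<union> g ` T) = Z"
      by (auto simp: gi K_def)
    have "?i ` (Z \<inter> g ` J) \<subseteq> ?i ` g ` J" by blast
    then show "(Z \<inter> J, ?i ` (Z \<inter> g ` J)) \<in> (Pow J \<inter> \<B>) \<times> (Pow J \<inter> \<B>)"
      using Z ig[of J] by (simp add: \<C>_def)
    show "(case (Z \<inter> J, ?i ` (Z \<inter> g ` J)) of (Y, T) \<Rightarrow> of_rat (w K (Y \<union> g ` T))) = real_of_rat (w K Z)"
      using eq by simp
  next
    fix p assume "p \<in> (Pow J \<inter> \<B>) \<times> (Pow J \<inter> \<B>)"
    then obtain Y T where p: "p = (Y, T)" "Y \<subseteq> J" "Y \<in> \<B>" "T \<subseteq> J" "T \<in> \<B>" by auto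
    have 1: "(Y \<union> g ` T) \<inter> J = Y" "(Y \<union> g ` T) \<inter> g ` J = g ` T"
      using p(2,4) g(2) by blast+
    then show "((case p of (Y, T) \<Rightarrow> Y \<union> g ` T) \<inter> J, ?i ` ((case p of (Y, T) \<Rightarrow> Y \<union> g ` T) \<inter> g ` J)) = p"
      using p(1) ig by simp
    show "(case p of (Y, T) \<Rightarrow> Y \<union> g ` T) \<in> Pow K \<inter> \<C>"
      using p 1 ig[of T] by (auto simp: K_def \<C>_def)
  qed
  also have "\<dots> = (\<Sum>(Y, T)\<in>(Pow J \<inter> \<B>) \<times> (Pow J \<inter> \<B>). of_rat (w J Y) * of_rat (w J T))"
    using g(3) by (intro sum.cong) (auto simp: K_def of_rat_mult)
  also have "\<dots> = (measure \<mu> (cyl J \<B>))\<^sup>2"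
    using measure_cyl[OF \<mu> J, of \<B>] by (simp add: power2_eq_square sum_product sum.cartesian_product)
  finally show ?thesis by (rule that[OF g(1)])
qed

text \<open>A set invariant up to null sets is close to a cylinder, hence also to the intersection
  of that cylinder with its independent shift. Its probability therefore equals its own
  square.\<close>

lemma has_law_ergodic:
  assumes \<mu>: "has_law \<mu>"
  shows "ergodic_prob (law_structure w) borel \<mu>"
  unfolding ergodic_prob_def
proof (intro conjI ballI impI)
  show "invariant_prob (law_structure w) borel \<mu>" by (rule has_law_invariant[OF \<mu>])
  interpret prob_space \<mu> using \<mu> by (rule has_lawD)
  fix A assume A: "A \<in> sets \<mu>"
    and inv: "\<forall>g\<in>Aut (law_structure w). measure \<mu> (sym_diff A (shift_act g ` A)) = 0"
  have close: "\<bar>prob B - prob C\<bar> \<le> prob (sym_diff B C)" if "B \<in> events" "C \<in> events" for B C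
  proof -
    have "prob B \<le> prob (C \<union> sym_diff B C)" "prob C \<le> prob (B \<union> sym_diff B C)"
      using that by (auto intro!: finite_measure_mono)
    moreover have "prob (C \<union> sym_diff B C) \<le> prob C + prob (sym_diff B C)"
      "prob (B \<union> sym_diff B C) \<le> prob B + prob (sym_diff B C)"
      using that by (auto intro!: measure_Un_le)
    ultimately show ?thesis by linarith
  qed
  \<comment> \<open>Replacing \<open>A\<close> and its shift by the cylinder and its shift costs
    \<open>2 * \<epsilon>\<close>; passing back from the square for the cylinder to that for
    \<open>A\<close> costs as much again, since the two probabilities add up to at most 2.\<close>
  have bound: "\<bar>prob A - (prob A)\<^sup>2\<bar> \<le> 4 * \<epsilon>" if \<epsilon>: "0 < \<epsilon>" for \<epsilon>
  proof -
    obtain J \<B> where J: "finite J" "prob (sym_diff A (cyl J \<B>)) < \<epsilon>"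
      using cyl_approximation[OF \<mu> A \<epsilon>] by blast
    define B where "B = cyl J \<B>"
    have B: "B \<in> events" using has_lawD(5)[OF \<mu> J(1)] by (simp add: B_def)
    obtain g where g: "g \<in> Aut (law_structure w)" "prob (B \<inter> shift_act g ` B) = (prob B)\<^sup>2"
      using cyl_mixing[OF \<mu> J(1), of \<B>] B_def by metis
    have bij: "bij g" using g(1) by (simp add: Aut_law_iff)
    let ?A = "shift_act g ` A" and ?B = "shift_act g ` B"
    have sets: "?A \<in> events" "?B \<in> events"
      using measure_shift_image(2)[OF \<mu> g(1)] A B by auto
    have "sym_diff ?A ?B = shift_act g ` sym_diff A B"
      unfolding shift_act_image[OF bij] by auto
    then have AB: "prob (sym_diff ?A ?B) < \<epsilon>"
      using measure_shift_image(1)[OF \<mu> g(1), of "sym_diff A B"] A B J(2) by (auto simp: B_def)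
    have "prob (sym_diff A (B \<inter> ?B)) \<le> prob (sym_diff A B \<union> sym_diff A ?A \<union> sym_diff ?A ?B)"
      using A B sets by (intro finite_measure_mono) auto
    also have "\<dots> \<le> prob (sym_diff A B \<union> sym_diff A ?A) + prob (sym_diff ?A ?B)"
      using A B sets by (intro measure_Un_le) auto
    also have "prob (sym_diff A B \<union> sym_diff A ?A) \<le> prob (sym_diff A B) + prob (sym_diff A ?A)"
      using A B sets by (intro measure_Un_le) auto
    finally have "prob (sym_diff A (B \<inter> ?B)) \<le> 2 * \<epsilon>"
      using inv g(1) AB J(2) by (simp add: B_def)
    then have 1: "\<bar>prob A - (prob B)\<^sup>2\<bar> \<le> 2 * \<epsilon>"
      using close[OF A, of "B \<inter> ?B"] B sets g(2) by auto
    have 2: "\<bar>prob B - prob A\<bar> \<le> \<epsilon>"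
      using close[OF A B] J(2) by (simp add: B_def abs_minus_commute)
    have "(prob B)\<^sup>2 - (prob A)\<^sup>2 = (prob B + prob A) * (prob B - prob A)"
      by (simp add: power2_eq_square algebra_simps)
    then have "\<bar>(prob B)\<^sup>2 - (prob A)\<^sup>2\<bar> = (prob B + prob A) * \<bar>prob B - prob A\<bar>"
      by (simp add: abs_mult)
    also have "\<dots> \<le> 2 * \<epsilon>"
    proof (rule mult_mono)
      show "prob B + prob A \<le> 2" using prob_le_1[of A] prob_le_1[of B] by linarith
    qed (use 2 in auto)
    finally show ?thesis using 1 by linarith
  qed
  have "\<bar>prob A - (prob A)\<^sup>2\<bar> \<le> 0 + \<epsilon>" if "0 < \<epsilon>" for \<epsilon>
    using bound[of "\<epsilon> / 4"] that by simp
  then have "\<bar>prob A - (prob A)\<^sup>2\<bar> \<le> 0" by (rule field_le_epsilon)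
  then have "prob A * (1 - prob A) = 0" by (simp add: power2_eq_square algebra_simps)
  then show "prob A = 0 \<or> prob A = 1" by simp
qed

lemma has_law_not_product:
  assumes \<mu>: "has_law \<mu>" and L: "prob_space L" "sets L = sets borel"
  shows "\<mu> \<noteq> PiM UNIV (\<lambda>_. L)"
proof
  assume eq: "\<mu> = PiM UNIV (\<lambda>_. L)"
  interpret L: prob_space L by (rule L(1))
  interpret product_prob_space "\<lambda>_. L" "UNIV :: nat set" ..
  \<comment> \<open>The point to be realised lies in the random set together with \<open>0\<close>
    with probability \<open>1/3\<close>, whereas independent fair bits would give
    \<open>1/4\<close>; the value \<open>1/6\<close> completes the sum to
    \<open>1/2\<close>.\<close>
  define v where "v T = (if T = {} then 1/6 else 1/3 :: rat)" for T :: "nat set"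
  have w0: "w {0} {} = 1/2"
    using split[of "{}" 0 "{}"] total half[of 0] by simp
  have "\<exists>b. b \<notin> {0} \<and> (\<forall>T\<subseteq>{0}. w (insert b {0}) (insert b T) = v T)"
  proof (rule ext)
    fix T :: "nat set" assume "T \<subseteq> {0}"
    then have "T = {} \<or> T = {0}" by auto
    then show "0 < v T \<and> v T < w {0} T" using w0 half[of 0] by (auto simp: v_def)
  next
    show "(\<Sum>T\<in>Pow {0}. v T) = 1/2" by (simp add: v_def Pow_insert)
  qed simp
  then obtain b where b: "b \<noteq> 0" "w {b, 0} {b, 0} = 1/3"
    by (metis insert_not_empty singletonI subset_refl v_def)
  have cyl: "measure \<mu> (cyl J {J}) = measure L {1} ^ card J" if J: "finite J" for J
  proof -
    have sp: "space (PiM UNIV (\<lambda>_. L)) = (UNIV :: (nat \<Rightarrow> real) set)"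
      using has_lawD(3)[OF \<mu>] eq by simp
    have "cyl J {J} = {x\<in>space (PiM UNIV (\<lambda>_. L)). \<forall>i\<in>J. x i \<in> {1}}"
      unfolding sp by (auto simp: cyl_def)
    moreover have "emeasure (PiM UNIV (\<lambda>_. L)) {x\<in>space (PiM UNIV (\<lambda>_. L)). \<forall>i\<in>J. x i \<in> {1}}
        = (\<Prod>i\<in>J. emeasure L {1})"
      using J L(2) by (intro emeasure_PiM_Collect) auto
    ultimately have "emeasure \<mu> (cyl J {J}) = ennreal (measure L {1} ^ card J)"
      unfolding eq by (simp add: L.emeasure_eq_measure ennreal_power)
    then show ?thesis by (simp add: measure_def)
  qed
  have half_L: "measure L {1} = 1/2"
    using cyl[of "{0}"] has_lawD(4)[OF \<mu>, of "{0}" "{0}"] half[of 0] by (simp add: of_rat_divide)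
  have "(measure L {1})\<^sup>2 = 1/3"
    using cyl[of "{b, 0}"] has_lawD(4)[OF \<mu>, of "{b, 0}" "{b, 0}"] b
    by (simp add: of_rat_divide numeral_2_eq_2)
  then show False unfolding half_L by (simp add: power2_eq_square)
qed

end

lemma standard_borel_borel: "standard_borel (borel :: real measure)"
  unfolding standard_borel_def
proof (intro exI[of _ euclidean] conjI)
  show "separable_space (euclidean :: real topology)"
  proof -
    obtain D :: "real set" where D: "countable D" "\<And>X. open X \<Longrightarrow> X \<noteq> {} \<Longrightarrow> \<exists>d\<in>D. d \<in> X"
      using countable_dense_setE by blast
    then have "euclidean closure_of D = topspace euclidean"
      unfolding dense_intersects_open open_openin[symmetric] by blast
    then show ?thesis using D(1) by (auto simp: separable_space_def)
  qed
qed (auto simp: completely_metrizable_space_euclidean borel_def)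

lemma (in generic) not_de_finetti: "\<not> de_finetti (law_structure w)"
proof
  assume dF: "de_finetti (law_structure w)"
  obtain \<mu> where \<mu>: "has_law \<mu>" using has_law_exists by blast
  obtain L where "prob_space L" "sets L = sets borel" "\<mu> = PiM UNIV (\<lambda>_. L)"
    using dF standard_borel_borel has_law_ergodic[OF \<mu>] unfolding de_finetti_def by fastforce
  then show False using has_law_not_product[OF \<mu>] by blast
qed

section \<open>Existence of generic laws\<close>

text \<open>Stage \<open>n\<close> proposes a kernel depending on \<open>X \<inter> {..<m}\<close> only, coded by \<open>m\<close> and the list of its
  values along \<open>set_encode\<close>. The first component of \<open>prod_decode\<close> repeats every kernel infinitely
  often.\<close>

definition proposed_kernel :: "nat \<Rightarrow> nat set \<Rightarrow> rat" where
  "proposed_kernel n X = (case from_nat (fst (prod_decode n)) of (m, l) \<Rightarrow> nth_default 0 l (set_encode (X \<inter> {..<m})))"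

lemma proposed_kernel_surj:
  fixes k :: "nat set \<Rightarrow> rat" and m :: nat
  obtains n where "m \<le> n" "\<And>X. proposed_kernel n X = k (X \<inter> {..<m})"
proof -
  obtain B where B: "\<forall>x\<in>set_encode ` Pow {..<m}. x < B"
    using finite_nat_set_iff_bounded[of "set_encode ` Pow {..<m}"] by auto
  define l where "l = map (\<lambda>i. k (set_decode i)) [0..<B]"
  have "nth_default 0 l (set_encode (X \<inter> {..<m})) = k (X \<inter> {..<m})" for X
    using B by (simp add: l_def nth_default_nth set_encode_inverse)
  \<comment> \<open>The repetition counter is taken to be \<open>m\<close>, which forces
    \<open>m \<le> n\<close>: the kernel reads only points decided before stage
    \<open>n\<close>.\<close>
  then have "proposed_kernel (prod_encode (to_nat (m, l), m)) X = k (X \<inter> {..<m})" for X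
    by (simp add: proposed_kernel_def)
  then show ?thesis using that le_prod_encode_2 by blast
qed

text \<open>\<open>W\<close> is the law of the trace on \<open>{..<n}\<close> and \<open>k\<close>
  the conditional probability of the point \<open>n\<close>; the average \<open>1/2\<close> is what
  \<open>half\<close> demands. A proposal whose list is too short for these patterns takes the
  default value \<open>0\<close> on some of them and is rejected here.\<close>

definition admissible :: "nat \<Rightarrow> (nat set \<Rightarrow> rat) \<Rightarrow> (nat set \<Rightarrow> rat) \<Rightarrow> bool" where
  "admissible n W k \<longleftrightarrow> (\<forall>X\<subseteq>{..<n}. 0 < k X \<and> k X < 1) \<and> (\<Sum>X\<in>Pow {..<n}. W X * k X) = 1/2"

text \<open>For \<open>T \<subseteq> {..<n}\<close>, \<open>stage n T\<close> is the probability
  that the trace on \<open>{..<n}\<close> is \<open>T\<close>. A rejected proposal is replaced by an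
  independent fair bit, which is always admissible.\<close>

primrec stage :: "nat \<Rightarrow> nat set \<Rightarrow> rat" where
  "stage 0 = (\<lambda>T. 1)"
| "stage (Suc n) = (\<lambda>T. let k = (if admissible n (stage n) (proposed_kernel n) then proposed_kernel n else (\<lambda>X. 1/2)) (T \<inter> {..<n})
     in stage n (T \<inter> {..<n}) * (if n \<in> T then k else 1 - k))"

definition stage_kernel :: "nat \<Rightarrow> nat set \<Rightarrow> rat" where
  "stage_kernel n = (if admissible n (stage n) (proposed_kernel n) then proposed_kernel n else (\<lambda>X. 1/2))"

lemma stage_Suc:
  assumes "T \<subseteq> {..<n}"
  shows "stage (Suc n) T = stage n T * (1 - stage_kernel n T)"
    "stage (Suc n) (insert n T) = stage n T * stage_kernel n T"
proof -
  have "n \<notin> T" "T \<inter> {..<n} = T" using assms by auto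
  then show "stage (Suc n) T = stage n T * (1 - stage_kernel n T)"
    "stage (Suc n) (insert n T) = stage n T * stage_kernel n T"
    by (simp_all add: stage_kernel_def Let_def)
qed

lemma stage_sum: "(\<Sum>T\<in>Pow {..<n}. stage n T) = 1"
proof (induction n)
  case (Suc n)
  have "(\<Sum>T\<in>Pow {..<Suc n}. stage (Suc n) T) = (\<Sum>T\<in>Pow {..<n}. stage n T)"
    unfolding lessThan_Suc sum_Pow_insert[OF finite_lessThan, of n n, simplified]
    by (rule sum.cong) (simp_all add: stage_Suc algebra_simps del: stage.simps)
  then show ?case using Suc by simp
qed simp

lemma stage_kernel_admissible: "admissible n (stage n) (stage_kernel n)"
proof (cases "admissible n (stage n) (proposed_kernel n)")
  case False
  then show ?thesis
    using stage_sum[of n] by (simp add: stage_kernel_def admissible_def sum_divide_distrib[symmetric])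
qed (simp add: stage_kernel_def)

lemma stage_pos: "T \<subseteq> {..<n} \<Longrightarrow> 0 < stage n T"
proof (induction n arbitrary: T)
  case (Suc n)
  define U where "U = T - {n}"
  have U: "U \<subseteq> {..<n}" using Suc.prems by (auto simp: U_def lessThan_Suc)
  have k: "0 < stage_kernel n U" "stage_kernel n U < 1"
    using stage_kernel_admissible[of n] U by (auto simp: admissible_def)
  have "T = U \<or> T = insert n U" by (auto simp: U_def)
  then show ?case using stage_Suc[OF U] Suc.IH[OF U] k by (auto simp del: stage.simps)
qed simp

definition partial_law :: "nat \<Rightarrow> nat set \<Rightarrow> nat set \<Rightarrow> rat" where
  "partial_law n S T = (\<Sum>Z\<in>{Z\<in>Pow {..<n}. Z \<inter> S = T}. stage n Z)"

text \<open>The least initial window is only a choice of representative: by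
  \<open>generic_law_eq\<close> any initial window containing \<open>S\<close> gives the same
  value.\<close>

definition generic_law :: "nat set \<Rightarrow> nat set \<Rightarrow> rat" where
  "generic_law S T = partial_law (LEAST n. S \<subseteq> {..<n}) S T"

text \<open>The counterpart of \<open>sum_marginal\<close> for initial windows, available before
  \<open>generic_law\<close> is known to be coherent.\<close>

lemma stage_sum_marginal:
  assumes "m \<le> n"
  shows "(\<Sum>Z\<in>Pow {..<n}. h (Z \<inter> {..<m}) * stage n Z) = (\<Sum>T\<in>Pow {..<m}. h T * stage m T)"
  using assms
proof (induction n rule: dec_induct)
  case base
  show ?case by (intro sum.cong) (auto simp: Int_absorb2)
next
  case (step n)
  have "(\<Sum>Z\<in>Pow {..<Suc n}. h (Z \<inter> {..<m}) * stage (Suc n) Z)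
      = (\<Sum>Z\<in>Pow {..<n}. h (Z \<inter> {..<m}) * stage n Z)"
    unfolding lessThan_Suc sum_Pow_insert[OF finite_lessThan, of n n, simplified]
  proof (rule sum.cong)
    fix Z assume "Z \<in> Pow {..<n}"
    then have Z: "Z \<subseteq> {..<n}" by simp
    have "insert n Z \<inter> {..<m} = Z \<inter> {..<m}" using step.hyps(1) by auto
    then show "h (Z \<inter> {..<m}) * stage (Suc n) Z + h (insert n Z \<inter> {..<m}) * stage (Suc n) (insert n Z)
        = h (Z \<inter> {..<m}) * stage n Z"
      unfolding stage_Suc[OF Z] by (simp add: algebra_simps)
  qed (auto simp: Pow_def)
  then show ?case using step.IH by simp
qed

lemma generic_law_eq:
  assumes "S \<subseteq> {..<n}"
  shows "generic_law S T = partial_law n S T"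
proof -
  define m where "m = (LEAST n. S \<subseteq> {..<n})"
  have m: "S \<subseteq> {..<m}" unfolding m_def by (rule LeastI[of "\<lambda>n. S \<subseteq> {..<n}", OF assms])
  have mn: "m \<le> n" unfolding m_def by (rule Least_le) (rule assms)
  have *: "partial_law n S T = (\<Sum>Z\<in>Pow {..<n}. of_bool (Z \<inter> S = T) * stage n Z)" for n
    unfolding partial_law_def sum_Collect_if[OF finite_Pow_iff[THEN iffD2, OF finite_lessThan], symmetric]
    by (rule sum.cong) auto
  have "(Z \<inter> {..<m}) \<inter> S = Z \<inter> S" for Z using m by auto
  then show ?thesis
    using stage_sum_marginal[OF mn, of "\<lambda>Z. of_bool (Z \<inter> S = T)"]
    by (simp add: * generic_law_def m_def)
qed

lemma generic_law_lessThan: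
  assumes "T \<subseteq> {..<n}"
  shows "generic_law {..<n} T = stage n T"
proof -
  have "{Z\<in>Pow {..<n}. Z \<inter> {..<n} = T} = {T}" using assms by auto
  then show ?thesis by (simp add: generic_law_eq[OF subset_refl] partial_law_def)
qed

lemma coherent_generic_law: "coherent generic_law"
proof
  show "generic_law {} {} = 1"
    by (subst generic_law_eq[of _ 0]) (auto simp: partial_law_def)
next
  fix S T :: "nat set" assume S: "finite S" "T \<subseteq> S"
  obtain n where "\<forall>i\<in>S. i < n" using S finite_nat_set_iff_bounded by auto
  then have n: "S \<subseteq> {..<n}" by auto
  then have T: "T \<in> {Z\<in>Pow {..<n}. Z \<inter> S = T}" using S by auto
  show "0 < generic_law S T"
    unfolding generic_law_eq[OF n] partial_law_def
    by (rule sum_pos) (use T stage_pos in auto)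
next
  fix S T :: "nat set" and a assume S: "finite S" "a \<notin> S" "T \<subseteq> S"
  obtain n where "\<forall>i\<in>insert a S. i < n" using S finite_nat_set_iff_bounded by blast
  then have n: "insert a S \<subseteq> {..<n}" by auto
  have "{Z\<in>Pow {..<n}. Z \<inter> S = T} = {Z\<in>Pow {..<n}. Z \<inter> insert a S = T} \<union> {Z\<in>Pow {..<n}. Z \<inter> insert a S = insert a T}"
    using S by auto
  moreover have "{Z\<in>Pow {..<n}. Z \<inter> insert a S = T} \<inter> {Z\<in>Pow {..<n}. Z \<inter> insert a S = insert a T} = {}"
    using S by auto
  ultimately show "generic_law S T = generic_law (insert a S) T + generic_law (insert a S) (insert a T)"
    using n by (simp add: generic_law_eq[of _ n] partial_law_def sum.union_disjoint)
qed

text \<open>A requirement \<open>v\<close> over \<open>S\<close> is divided by the law of the trace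
  on \<open>S\<close>, which gives a kernel. It is proposed at some stage \<open>n\<close> beyond
  \<open>S\<close> and accepted because its average is the sum of \<open>v\<close>; the point
  \<open>n\<close> then realises the requirement.\<close>

lemma generic_generic_law: "generic generic_law"
proof -
  interpret coherent generic_law by (rule coherent_generic_law)
  show ?thesis
  proof
    fix a :: nat
    have "generic_law (insert a {}) (insert a {})
      = (\<Sum>Z\<in>{Z\<in>Pow {..<a}. Z \<inter> {} = {}}. generic_law (insert a {..<a}) (insert a Z))"
      by (rule marginal_insert) auto
    also have "{Z\<in>Pow {..<a}. Z \<inter> {} = {}} = Pow {..<a}" by auto
    also have "(\<Sum>Z\<in>Pow {..<a}. generic_law (insert a {..<a}) (insert a Z))
      = (\<Sum>Z\<in>Pow {..<a}. stage a Z * stage_kernel a Z)"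
    proof (rule sum.cong)
      fix Z assume Z: "Z \<in> Pow {..<a}"
      then have "generic_law {..<Suc a} (insert a Z) = stage (Suc a) (insert a Z)"
        by (intro generic_law_lessThan) auto
      then show "generic_law (insert a {..<a}) (insert a Z) = stage a Z * stage_kernel a Z"
        using stage_Suc(2)[of Z a] Z by (simp add: lessThan_Suc del: stage.simps)
    qed simp
    also have "\<dots> = 1/2" using stage_kernel_admissible[of a] by (simp add: admissible_def)
    finally show "generic_law {a} {a} = 1/2" .
  next
    fix S and v :: "nat set \<Rightarrow> rat"
    assume S: "finite S" and v: "\<And>T. T \<subseteq> S \<Longrightarrow> 0 < v T \<and> v T < generic_law S T"
      and sum: "(\<Sum>T\<in>Pow S. v T) = 1/2"
    obtain m where "\<forall>i\<in>S. i < m" using S finite_nat_set_iff_bounded by auto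
    then have m: "S \<subseteq> {..<m}" by auto
    define k where "k X = v (X \<inter> S) / generic_law S (X \<inter> S)" for X
    have k: "0 < k X" "k X < 1" for X
      using v[of "X \<inter> S"] pos[OF S, of "X \<inter> S"] by (auto simp: k_def)
    obtain n where n: "m \<le> n" "\<And>X. proposed_kernel n X = k (X \<inter> {..<m})"
      using proposed_kernel_surj[of m k] by blast
    have "(X \<inter> {..<m}) \<inter> S = X \<inter> S" for X using m by auto
    then have kernel_eq: "proposed_kernel n X = k X" "k (X \<inter> S) = k X" for X by (simp_all add: n(2) k_def)
    have Sn: "S \<subseteq> {..<n}" using m n(1) by auto
    have adm: "admissible n (stage n) (proposed_kernel n)"
      unfolding admissible_def
    proof (intro conjI allI impI)
      have "(\<Sum>X\<in>Pow {..<n}. stage n X * proposed_kernel n X)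
        = (\<Sum>X\<in>Pow {..<n}. k (X \<inter> S) * generic_law {..<n} X)"
        by (intro sum.cong) (auto simp: kernel_eq generic_law_lessThan)
      also have "\<dots> = (\<Sum>T\<in>Pow S. k T * generic_law S T)"
        by (rule sum_marginal[OF finite_lessThan Sn])
      also have "\<dots> = (\<Sum>T\<in>Pow S. v T)"
      proof (rule sum.cong)
        fix T assume "T \<in> Pow S"
        then have "T \<inter> S = T" "generic_law S T \<noteq> 0" using pos[OF S, of T] by auto
        then show "k T * generic_law S T = v T" by (simp add: k_def)
      qed simp
      finally show "(\<Sum>X\<in>Pow {..<n}. stage n X * proposed_kernel n X) = 1/2" using sum by simp
    qed (simp_all add: kernel_eq k)
    have "generic_law (insert n S) (insert n T) = v T" if T: "T \<subseteq> S" for T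
    proof -
      have "generic_law (insert n S) (insert n T)
        = (\<Sum>Z\<in>{Z\<in>Pow {..<n}. Z \<inter> S = T}. generic_law (insert n {..<n}) (insert n Z))"
        by (rule marginal_insert) (use Sn T in auto)
      also have "\<dots> = (\<Sum>Z\<in>{Z\<in>Pow {..<n}. Z \<inter> S = T}. k T * generic_law {..<n} Z)"
      proof (rule sum.cong)
        fix Z assume Z: "Z \<in> {Z\<in>Pow {..<n}. Z \<inter> S = T}"
        then have "generic_law {..<Suc n} (insert n Z) = stage (Suc n) (insert n Z)"
          by (intro generic_law_lessThan) auto
        moreover have "stage_kernel n Z = k T"
          using adm Z kernel_eq[of Z] by (simp add: stage_kernel_def)
        ultimately show "generic_law (insert n {..<n}) (insert n Z) = k T * generic_law {..<n} Z"
          using stage_Suc(2)[of Z n] Z by (simp add: lessThan_Suc generic_law_lessThan del: stage.simps)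
      qed simp
      also have "\<dots> = k T * generic_law S T"
        using marginal[OF finite_lessThan Sn T] by (simp add: sum_distrib_left)
      also have "\<dots> = v T"
      proof -
        have "T \<inter> S = T" "generic_law S T \<noteq> 0" using T pos[OF S T] by auto
        then show ?thesis by (simp add: k_def)
      qed
      finally show ?thesis .
    qed
    moreover have "n \<notin> S" using Sn by auto
    ultimately show "\<exists>b. b \<notin> S \<and> (\<forall>T\<subseteq>S. generic_law (insert b S) (insert b T) = v T)" by blast
  qed
qed

theorem theorem4:
  shows "\<exists>(ar :: nat \<Rightarrow> nat) (M :: (nat, nat) rel_structure).
           fraisse_limit ar M \<and> transitive_structure M \<and> no_algebraicity M \<and>
           weak_elimination_of_imaginaries M \<and> \<not> de_finetti M"
proof -
  interpret generic generic_law by (rule generic_generic_law)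
  show ?thesis
    using fraisse_limit_law transitive_law no_algebraicity_law weak_elimination_law not_de_finetti
    by blast
qed

end
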